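(* Let $G$ be a finite non-bipartite graph with chromatic number $\chi(G)$. Then $\chi(G)\neq\chi_c(G)$ if and only if there exist non-negative integers $r,s$ with $\frac{2r+1}{2s+1}>\frac{\chi(G)}{3(\chi(G)-2)}$ such that $\chi(G^{\frac{2r+1}{2s+1}})=3$. Moreover, $$\chi_c(G)=\inf\Big\{\tfrac{2n+1}{n-t}\ :\ \chi\big(G^{\frac{2n+1}{3(2t+1)}}\big)=3,\ n>t>0\Big\}.$$ Also, if $r,s$ are non-negative integers with $\frac{2r+1}{2s+1}\leq \frac{\chi(G)}{3(\chi(G)-2)}$, then $\chi(G^{\frac{2r+1}{2s+1}})=3$.
   Context: All graphs are finite. For a positive integer $k$, $G^{k}$ has vertex set $V(G)$, with $u,v$ adjacent iff there is a walk of length $k$ between them in $G$. $S_t(G)$ is obtained from $G$ by replacing each edge by a path with exactly $t-1$ inner vertices, and for non-negative integers $a,b$, $G^{\frac{2a+1}{2b+1}}:=(S_{2b+1}(G))^{2a+1}$ (in particular $G^{\frac{2n+1}{3(2t+1)}}=(S_{3(2t+1)}(G))^{2n+1}$). For integers $n\ge 2d\ge 2$, the circular complete graph $K_{n/d}$ has vertices $v_0,\ldots,v_{n-1}$ with $v_i v_j$ an edge iff $d\le |i-j|\le n-d$. The circular chromatic number $\chi_c(G)$ is the minimum of $n/d$ such that $G$ admits a homomorphism to $K_{n/d}$. *)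

theory Defs
  imports Complex_Main "HOL-Library.Extended_Nat" "Graph_Theory.Pair_Digraph"
begin

text \<open>Undirected graphs are symmetric digraphs without parallel arcs: an edge \<open>uv\<close> is the pair of
  arcs \<open>(u, v)\<close> and \<open>(v, u)\<close>. Finite simple graphs are those in the locale \<open>pair_graph\<close>; graph
  powers may have loops and live in the locale \<open>pair_pseudo_graph\<close>.\<close>

definition bipartite :: "'a pair_pre_digraph \<Rightarrow> bool" where
  "bipartite G \<longleftrightarrow> (\<exists>A B. A \<union> B = pverts G \<and> A \<inter> B = {} \<and> parcs G \<subseteq> A \<times> B \<union> B \<times> A)"

definition proper_coloring :: "'a pair_pre_digraph \<Rightarrow> nat \<Rightarrow> ('a \<Rightarrow> nat) \<Rightarrow> bool" where
  "proper_coloring G k c \<longleftrightarrow> c ` pverts G \<subseteq> {..<k} \<and> (\<forall>(u, v) \<in> parcs G. c u \<noteq> c v)"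

text \<open>The infimum in \<^typ>\<open>enat\<close> is a minimum if there is a proper colouring at all, and \<open>\<infinity>\<close>
  otherwise. The latter case occurs for graphs with loops, so that these are never 3-chromatic.\<close>

definition chromatic_number :: "'a pair_pre_digraph \<Rightarrow> enat" where
  "chromatic_number G = Inf {enat k |k. \<exists>c. proper_coloring G k c}"

definition graph_hom :: "'a pair_pre_digraph \<Rightarrow> 'b pair_pre_digraph \<Rightarrow> ('a \<Rightarrow> 'b) \<Rightarrow> bool" where
  "graph_hom G H f \<longleftrightarrow>
     f ` pverts G \<subseteq> pverts H \<and> (\<forall>(u, v) \<in> parcs G. (f u, f v) \<in> parcs H)"

definition circular_complete :: "nat \<Rightarrow> nat \<Rightarrow> nat pair_pre_digraph" where
  "circular_complete n d = \<lparr>pverts = {..<n},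
     parcs = {(i, j). i < n \<and> j < n \<and>
       int d \<le> \<bar>int i - int j\<bar> \<and> \<bar>int i - int j\<bar> \<le> int n - int d}\<rparr>"

definition circular_chromatic_number :: "'a pair_pre_digraph \<Rightarrow> real" where
  "circular_chromatic_number G = (LEAST x. \<exists>n d. x = real n / real d \<and>
     n \<ge> 2 * d \<and> 2 * d \<ge> 2 \<and> (\<exists>f. graph_hom G (circular_complete n d) f))"

definition graph_power :: "'a pair_pre_digraph \<Rightarrow> nat \<Rightarrow> 'a pair_pre_digraph" where
  "graph_power G k = \<lparr>pverts = pverts G,
     parcs = {(u, v). \<exists>p. pre_digraph.awalk (with_proj G) u p v \<and> length p = k}\<rparr>"

text \<open>\<open>subdiv_point t u v i\<close> is the vertex at distance \<open>i\<close> from \<open>u\<close> on the path of length \<open>t\<close> that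
  replaces the edge \<open>uv\<close>. An inner vertex carries both of its descriptions, from \<open>u\<close> and from \<open>v\<close>,
  so that no orientation of the edges has to be chosen (see \<open>subdiv_point_rev\<close>).\<close>

definition subdiv_point :: "nat \<Rightarrow> 'a \<Rightarrow> 'a \<Rightarrow> nat \<Rightarrow> 'a + ('a \<times> 'a \<times> nat) set" where
  "subdiv_point t u v i =
     (if i = 0 then Inl u else if i = t then Inl v else Inr {(u, v, i), (v, u, t - i)})"

text \<open>For symmetric \<open>G\<close> the arcs of \<open>S\<^sub>t(G)\<close> come in both directions, as \<open>(u, v)\<close> and \<open>(v, u)\<close> both
  contribute. Only \<open>t \<ge> 1\<close> is meaningful.\<close>

definition subdiv :: "nat \<Rightarrow> 'a pair_pre_digraph \<Rightarrow> ('a + ('a \<times> 'a \<times> nat) set) pair_pre_digraph" where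
  "subdiv t G = \<lparr>
     pverts = Inl ` pverts G \<union> {subdiv_point t u v i |u v i. (u, v) \<in> parcs G \<and> 0 < i \<and> i < t},
     parcs = {(subdiv_point t u v i, subdiv_point t u v (i + 1)) |u v i. (u, v) \<in> parcs G \<and> i < t}\<rparr>"

text \<open>The exponent \<open>p/q\<close> is a formal fraction: \<open>p\<close> and \<open>q\<close> are not reduced to lowest terms.\<close>

definition frac_power ::
  "'a pair_pre_digraph \<Rightarrow> nat \<Rightarrow> nat \<Rightarrow> ('a + ('a \<times> 'a \<times> nat) set) pair_pre_digraph" where
  "frac_power G p q = graph_power (subdiv q G) p"

lemma subdiv_point_rev:
  assumes "i \<le> t" "t \<ge> 1"
  shows "subdiv_point t v u (t - i) = subdiv_point t u v i"
  using assms by (auto simp: subdiv_point_def)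

lemma subdiv_point_Suc_neq:
  assumes "u \<noteq> v" "i < t"
  shows "subdiv_point t u v i \<noteq> subdiv_point t u v (Suc i)"
  using assms by (auto simp: subdiv_point_def doubleton_eq_iff)

lemma pair_graph_subdiv:
  assumes "pair_graph G" "t \<ge> 1"
  shows "pair_graph (subdiv t G)"
proof -
  interpret pair_graph G by fact
  have P: "subdiv_point t u v i \<in> pverts (subdiv t G)" if "(u, v) \<in> parcs G" "i \<le> t" for u v i
  proof -
    have "u \<in> pverts G" "v \<in> pverts G" using that by (auto dest: in_arcsD1 in_arcsD2)
    then have "i = 0 \<or> i = t \<Longrightarrow> ?thesis"
      by (auto simp: subdiv_def subdiv_point_def)
    moreover have "0 < i \<and> i < t \<Longrightarrow> ?thesis"
      using that unfolding subdiv_def by auto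
    ultimately show ?thesis using that by linarith
  qed
  have A: "parcs (subdiv t G) =
    (\<lambda>((u, v), i). (subdiv_point t u v i, subdiv_point t u v (i + 1))) ` (parcs G \<times> {..<t})"
    by (force simp: subdiv_def)
  have V: "pverts (subdiv t G) \<subseteq> Inl ` pverts G \<union>
    (\<lambda>((u, v), i). subdiv_point t u v i) ` (parcs G \<times> {..<t})"
    by (force simp: subdiv_def)
  have S: "(y, x) \<in> parcs (subdiv t G)" if "(x, y) \<in> parcs (subdiv t G)" for x y
  proof -
    from that obtain u v i where *: "(u, v) \<in> parcs G" "i < t"
      "x = subdiv_point t u v i" "y = subdiv_point t u v (i + 1)" by (auto simp: subdiv_def)
    have "x = subdiv_point t v u (t - i - 1 + 1)" "y = subdiv_point t v u (t - i - 1)"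
      using * subdiv_point_rev[of i t v u] subdiv_point_rev[of "i + 1" t v u] assms(2)
      by (auto simp: Suc_diff_Suc)
    moreover have "(v, u) \<in> parcs G" "t - i - 1 < t" using * arcs_symmetric by auto
    ultimately show ?thesis unfolding subdiv_def by auto
  qed
  show ?thesis
  proof
    show "finite (pverts (subdiv t G))"
      by (rule finite_subset[OF V]) (use pair_finite_verts pair_finite_arcs in auto)
    show "finite (parcs (subdiv t G))"
      unfolding A using pair_finite_arcs by auto
    show "symmetric (with_proj (subdiv t G))"
      using S by (auto simp: symmetric_def intro: symI)
  next
    fix e assume "e \<in> parcs (subdiv t G)"
    then obtain u v i where *: "(u, v) \<in> parcs G" "i < t"
      "e = (subdiv_point t u v i, subdiv_point t u v (i + 1))" by (auto simp: subdiv_def)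
    show "fst e \<in> pverts (subdiv t G)" "snd e \<in> pverts (subdiv t G)" using * P by auto
    show "fst e \<noteq> snd e" using * subdiv_point_Suc_neq[OF no_loops'[OF *(1)] *(2)] by simp
  qed
qed

lemma chromatic_number_finite:
  assumes "pair_graph G"
  shows "\<exists>k. chromatic_number G = enat k"
proof -
  interpret pair_graph G by fact
  obtain c :: "'a \<Rightarrow> nat" and k where c: "c ` pverts G = {i. i < k}" "inj_on c (pverts G)"
    using finite_imp_inj_to_nat_seg[OF pair_finite_verts] by blast
  have "proper_coloring G k c"
    using c no_loops' in_arcsD1 in_arcsD2 by (fastforce simp: proper_coloring_def dest: inj_onD)
  then have "chromatic_number G \<le> enat k"
    unfolding chromatic_number_def by (intro Inf_lower) auto
  then show ?thesis by (cases "chromatic_number G") auto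
qed

end

theory Submission
  imports Defs "HOL-Number_Theory.Cong"
begin

text \<open>For odd \<open>p\<close> and \<open>q\<close>, the graph \<open>S\<^sub>q(G)\<^sup>p\<close> is 3-colourable iff
  \<open>\<chi>\<^sub>c(G) (3p - q) \<le> 6p\<close>; everything else is arithmetic, together with the density of the
  fractions \<open>(2n+1)/(n-t)\<close> above 2. Indeed \<open>H\<^sup>p\<close> is 3-colourable iff \<open>H\<close> maps to the cycle of
  length \<open>3p\<close>, equivalently to \<open>K\<^bsub>6p/(3p-1)\<^esub>\<close>, whose edges are the almost antipodal pairs of \<open>\<int>/6p\<close>,
  with an error of at most 1. Along a path of \<open>q\<close> edges these errors add up to at most \<open>q\<close>, and any error
  up to \<open>q\<close> can be distributed along the path; so \<open>S\<^sub>q(G)\<close> maps to \<open>K\<^bsub>6p/(3p-1)\<^esub>\<close> iff \<open>G\<close> maps to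
  \<open>K\<^bsub>6p/(3p-q)\<^esub>\<close>. That the minimum defining \<open>\<chi>\<^sub>c\<close> is attained follows since a map to \<open>K\<^bsub>n/d\<^esub>\<close>
  that misses a vertex can be improved to a smaller \<open>K\<^bsub>n'/d'\<^esub>\<close> with \<open>n'/d' < n/d\<close>.\<close>

subsection \<open>Circular colourings\<close>

text \<open>For symmetric \<open>E\<close> the bound applied to \<open>(v, u)\<close> gives the upper bound \<open>n - d\<close> for \<open>(u, v)\<close>.\<close>

definition circ_coloring :: "('a \<times> 'a) set \<Rightarrow> int \<Rightarrow> int \<Rightarrow> ('a \<Rightarrow> int) \<Rightarrow> bool" where
  "circ_coloring E n d c \<longleftrightarrow> (\<forall>(u, v) \<in> E. d \<le> (c v - c u) mod n)"

lemma circ_coloringI: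
  assumes "\<And>u v. (u, v) \<in> E \<Longrightarrow> \<exists>e z. c v - c u = e + z * n \<and> d \<le> e \<and> e < n" and "d \<ge> 0"
  shows "circ_coloring E n d c"
  unfolding circ_coloring_def
proof safe
  fix u v assume "(u, v) \<in> E"
  then obtain e z where *: "c v - c u = e + z * n" "d \<le> e" "e < n" using assms by blast
  then have "(c v - c u) mod n = e" using assms(2) by simp
  then show "d \<le> (c v - c u) mod n" using * by simp
qed

lemma circ_coloringE:
  assumes "circ_coloring E n d c" "sym E" "(u, v) \<in> E" "d > 0" "n > 0"
  obtains e z where "c v - c u = e + z * n" "d \<le> e" "e \<le> n - d"
proof
  let ?e = "(c v - c u) mod n"
  show "c v - c u = ?e + ((c v - c u) div n) * n" by (simp add: mult.commute)
  have 1: "d \<le> ?e" using assms by (auto simp: circ_coloring_def)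
  then show "d \<le> ?e" .
  have 2: "d \<le> (c u - c v) mod n" using assms by (auto simp: circ_coloring_def dest: symD)
  have "(c u - c v) mod n = n - ?e"
    using zmod_zminus1_eq_if[of "c v - c u" n] 1 assms by (auto split: if_splits)
  then show "?e \<le> n - d" using 2 by simp
qed

text \<open>Vertices of the circular complete graph are read as residues mod \<open>n\<close>. For
  representatives below \<open>n\<close>, the distance \<open>|i - j|\<close> is either the residue
  \<open>e\<close> of the difference or \<open>n - e\<close>, and the range from \<open>d\<close> to
  \<open>n - d\<close> is invariant under exchanging these two.\<close>

lemma graph_hom_circular_complete_iff:
  assumes "pair_graph G" "n \<ge> 2 * d" "d \<ge> 1"
  shows "(\<exists>f. graph_hom G (circular_complete n d) f) \<longleftrightarrow>
    (\<exists>c. circ_coloring (parcs G) (int n) (int d) c)"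
proof
  interpret pair_graph G by fact
  have sym: "sym (parcs G)" using sym_arcs by (auto simp: symmetric_def)
  {
    assume "\<exists>f. graph_hom G (circular_complete n d) f"
    then obtain f where f: "graph_hom G (circular_complete n d) f" by blast
    have "circ_coloring (parcs G) n d (\<lambda>v. int (f v))"
    proof (rule circ_coloringI)
      fix u v assume "(u, v) \<in> parcs G"
      then have *: "int d \<le> \<bar>int (f u) - int (f v)\<bar>" "\<bar>int (f u) - int (f v)\<bar> \<le> int n - int d"
        using f by (auto simp: graph_hom_def circular_complete_def)
      show "\<exists>e z. int (f v) - int (f u) = e + z * int n \<and> int d \<le> e \<and> e < int n"
      proof (cases "f u \<le> f v")
        case True
        then show ?thesis using * assms by (intro exI[of _ "int (f v) - int (f u)"] exI[of _ 0]) auto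
      next
        case False
        then show ?thesis using * assms
          by (intro exI[of _ "int (f v) - int (f u) + n"] exI[of _ "-1"]) auto
      qed
    qed simp
    then show "\<exists>c. circ_coloring (parcs G) (int n) (int d) c" by blast
  }
  {
    assume "\<exists>c. circ_coloring (parcs G) (int n) (int d) c"
    then obtain c where c: "circ_coloring (parcs G) (int n) (int d) c" by blast
    define f where "f v = nat (c v mod n)" for v
    have n: "n > 0" using assms by simp
    have f: "int (f v) = c v mod n" "f v < n" for v
      using n by (auto simp: f_def nat_less_iff)
    have "graph_hom G (circular_complete n d) f"
      unfolding graph_hom_def
    proof safe
      fix v show "f v \<in> pverts (circular_complete n d)" using f by (auto simp: circular_complete_def)
    next
      fix u v assume "(u, v) \<in> parcs G"
      then obtain e z :: int where e: "c v - c u = e + z * n" "int d \<le> e" "e \<le> n - int d"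
        using circ_coloringE[OF c sym, of u v] assms n by auto
      have "(int (f v) - int (f u)) mod n = e mod n"
        unfolding f using e(1) by (metis mod_diff_eq mod_mult_self1)
      also have "\<dots> = e" using e assms by (intro mod_pos_pos_trivial) auto
      finally have m: "(int (f v) - int (f u)) mod n = e" .
      have "\<bar>int (f u) - int (f v)\<bar> = e \<or> \<bar>int (f u) - int (f v)\<bar> = n - e"
      proof (cases "f u \<le> f v")
        case True
        then have "(int (f v) - int (f u)) mod n = int (f v) - int (f u)"
          using f(2)[of u] f(2)[of v] by (intro mod_pos_pos_trivial) auto
        then show ?thesis using m True by auto
      next
        case False
        then have "(int (f v) - int (f u) + n) mod n = int (f v) - int (f u) + n"
          using f(2)[of u] f(2)[of v] by (intro mod_pos_pos_trivial) auto
        then show ?thesis using m False by auto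
      qed
      then show "(f u, f v) \<in> parcs (circular_complete n d)"
        using e f(2) by (auto simp: circular_complete_def)
    qed
    then show "\<exists>f. graph_hom G (circular_complete n d) f" by blast
  }
qed

text \<open>The circle of length \<open>n\<close> is rescaled by n'/n and rounded down. The last
  hypothesis says n/d \<le> n'/d', so a gap of \<open>d\<close> is stretched to at least the integer
  \<open>d'\<close>, which survives rounding.\<close>

lemma circ_coloring_mono:
  assumes "circ_coloring E n d c" "sym E" "d > 0" "n > 0" "d' > 0" "n * d' \<le> n' * d"
  shows "circ_coloring E n' d' (\<lambda>v. (c v * n') div n)"
proof (rule circ_coloringI)
  fix u v assume "(u, v) \<in> E"
  then obtain e z where e: "c v - c u = e + z * n" "d \<le> e" "e \<le> n - d"
    using circ_coloringE[OF assms(1,2) _ assms(3,4)] by metis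
  have n': "n' > 0" using assms by (smt (verit) mult_pos_pos zero_less_mult_pos2)
  have up: "(a * n') div n + d' \<le> (b * n') div n" if "a + d \<le> b" for a b
  proof -
    have "a * n' + d' * n \<le> (a + d) * n'" using assms(6) by (simp add: algebra_simps)
    also have "\<dots> \<le> b * n'" using that n' by (simp add: mult_right_mono)
    finally have "(a * n' + d' * n) div n \<le> (b * n') div n" using assms by (intro zdiv_mono1) auto
    then show ?thesis using assms by simp
  qed
  have per: "((a + k * n) * n') div n = (a * n') div n + k * n'" for a k
  proof -
    have "(a + k * n) * n' = a * n' + (k * n') * n" by (simp add: algebra_simps)
    then show ?thesis using assms by simp
  qed
  have cv: "c v = (c u + e) + z * n" using e by simp
  have 1: "(c u * n') div n + d' \<le> ((c u + e) * n') div n" using up e by simp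
  \<comment> \<open>The complementary gap from \<open>c u + e\<close> to \<open>c u + n\<close> also
    has length at least \<open>d\<close>; stretching it bounds the first gap by
    \<open>n' - d'\<close>.\<close>
  have 2: "((c u + e) * n') div n + d' \<le> (c u * n') div n + n'"
    using up[of "c u + e" "c u + 1 * n"] per[of "c u" 1] e by simp
  show "\<exists>e z. (c v * n') div n - (c u * n') div n = e + z * n' \<and> d' \<le> e \<and> e < n'"
    using 1 2 assms(5) unfolding cv per
    by (intro exI[of _ "((c u + e) * n') div n - (c u * n') div n"] exI[of _ z]) auto
qed (use assms in simp)

text \<open>If \<open>n d' - n' d = 1\<close>, the map \<open>i \<mapsto> \<lfloor>i n' / n\<rfloor>\<close> fails to be a homomorphism from \<open>K\<^bsub>n/d\<^esub>\<close> to
  \<open>K\<^bsub>n'/d'\<^esub>\<close> only at the vertex \<open>0\<close>.\<close>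

lemma circ_coloring_avoid:
  assumes "circ_coloring E n d c" "sym E" "d > 0" "n > 0" "d' > 0" "n' > 0" "n * d' = n' * d + 1"
    and avoid: "\<And>u. u \<in> Field E \<Longrightarrow> \<not> n dvd c u"
  shows "circ_coloring E n' d' (\<lambda>v. (c v * n') div n)"
proof (rule circ_coloringI)
  fix u v assume uv: "(u, v) \<in> E"
  then obtain e z where e: "c v - c u = e + z * n" "d \<le> e" "e \<le> n - d"
    using circ_coloringE[OF assms(1,2) _ assms(3,4)] by metis
  have cop: "coprime n n'"
  proof (rule coprimeI)
    fix l assume "l dvd n" "l dvd n'"
    then have "l dvd n * d' - n' * d" by simp
    then show "is_unit l" using assms(7) by simp
  qed
  have up: "(a * n') div n + d' \<le> (b * n') div n" if "a + d \<le> b" and a: "\<not> n dvd a" for a b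
  proof -
    have nd: "\<not> n dvd a * n'" using a cop by (simp add: coprime_dvd_mult_left_iff)
    \<comment> \<open>The remainder of at least 1 lost in rounding pays for the excess 1 in
      \<open>n * d' = n' * d + 1\<close>.\<close>
    have "(a * n') mod n \<ge> 1" using nd assms(4)
      by (smt (verit) dvd_eq_mod_eq_0 pos_mod_sign)
    then have "(a * n') div n * n \<le> a * n' - 1"
      by (smt (verit) div_mult_mod_eq)
    then have "((a * n') div n + d') * n \<le> (a + d) * n'"
      using assms(7) by (simp add: algebra_simps)
    also have "\<dots> \<le> b * n'" using that assms by (simp add: mult_right_mono)
    finally show ?thesis using zdiv_mono1[of "((a * n') div n + d') * n" "b * n'" n] assms by simp
  qed
  have per: "((a + k * n) * n') div n = (a * n') div n + k * n'" for a k
  proof -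
    have "(a + k * n) * n' = a * n' + (k * n') * n" by (simp add: algebra_simps)
    then show ?thesis using assms by simp
  qed
  have cv: "c v = (c u + e) + z * n" using e by simp
  have "\<not> n dvd c u" "\<not> n dvd c v" using avoid uv by (auto intro: FieldI1 FieldI2)
  then have nd: "\<not> n dvd c u" "\<not> n dvd c u + e" unfolding cv by auto
  have 1: "(c u * n') div n + d' \<le> ((c u + e) * n') div n" using up e nd by simp
  have 2: "((c u + e) * n') div n + d' \<le> (c u * n') div n + n'"
    using up[of "c u + e" "c u + 1 * n"] per[of "c u" 1] e nd by simp
  show "\<exists>e z. (c v * n') div n - (c u * n') div n = e + z * n' \<and> d' \<le> e \<and> e < n'"
    using 1 2 assms(5) unfolding cv per
    by (intro exI[of _ "((c u + e) * n') div n - (c u * n') div n"] exI[of _ z]) auto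
qed (use assms in simp)

text \<open>For \<open>d\<close> \<ge> 2 take \<open>d'\<close> as the inverse of \<open>n\<close>
  modulo \<open>d\<close>. The equation says n'/d' = n/d - 1/(d d'), so n'/d' is a Farey neighbour
  of n/d from below.\<close>

lemma ex_inverse_mod_range:
  fixes n d :: nat
  assumes "coprime n d" "n \<ge> 2 * d" "d \<ge> 1" "n > 2"
  shows "\<exists>n' d'. n * d' = n' * d + 1 \<and> n' < n \<and> d' \<ge> 1 \<and> n' \<ge> 2 * d'"
proof (cases "d = 1")
  case True
  then show ?thesis using assms by (intro exI[of _ "n - 1"] exI[of _ 1]) auto
next
  case False
  then have d: "d \<ge> 2" using assms by simp
  obtain x where x: "[n * x = 1] (mod d)"
    using cong_solve_coprime_nat[OF assms(1)] by auto
  define d' where "d' = x mod d"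
  have "[n * d' = 1] (mod d)" unfolding d'_def using x
    by (metis cong_def mod_mult_right_eq)
  then have m: "(n * d') mod d = 1" using d by (simp add: cong_def)
  define n' where "n' = (n * d') div d"
  have eq: "n * d' = n' * d + 1" using m by (metis n'_def div_mult_mod_eq)
  have d': "d' \<ge> 1" using eq by (cases d') auto
  have "d' < d" unfolding d'_def using d by simp
  then have "n * d' \<le> n * d" by simp
  then have "n' * d < n * d" using eq by linarith
  then have n': "n' < n" by simp
  \<comment> \<open>Coprimality excludes \<open>n = 2 * d\<close> for \<open>d\<close> \<ge> 2; the
    slack gained here keeps \<open>n'\<close> at least \<open>2 * d'\<close>.\<close>
  have "n \<noteq> 2 * d"
  proof
    assume "n = 2 * d"
    then have "d dvd gcd n d" by simp
    then show False using assms(1) d by (simp add: coprime_iff_gcd_eq_1)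
  qed
  then have "n \<ge> 2 * d + 1" using assms by simp
  then have "(2 * d + 1) * d' \<le> n * d'" by (rule mult_right_mono) simp
  moreover have "(2 * d + 1) * d' = (2 * d') * d + d'" by (simp add: algebra_simps)
  ultimately have "(2 * d') * d \<le> n' * d" using eq d' by linarith
  then have "2 * d' \<le> n'" using d by simp
  then show ?thesis using eq n' d' by blast
qed

text \<open>Descent on \<open>n\<close>. A common factor of \<open>n\<close> and \<open>d\<close> is
  cancelled; if they are coprime and \<open>n\<close> exceeds both 2 and the number of vertices,
  some residue is missed and the map improves to the lower Farey neighbour. In the end only finitely
  many fractions compete.\<close>

lemma circ_coloring_reduce:
  fixes n d :: nat
  assumes "sym E" "E \<subseteq> V \<times> V" "finite V" "circ_coloring E n d c" "n \<ge> 2 * d" "d \<ge> 1"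
  shows "\<exists>n' d' c'. circ_coloring E (int n') (int d') c' \<and> n' \<le> max 2 (card V) \<and>
    n' \<ge> 2 * d' \<and> d' \<ge> 1 \<and> n' * d \<le> n * d'"
  using assms(4-6)
proof (induction n arbitrary: d c rule: less_induct)
  case (less n d c)
  have step: ?case if *: "n1 < n" "circ_coloring E (int n1) (int d1) c1" "n1 \<ge> 2 * d1" "d1 \<ge> 1"
    "n1 * d \<le> n * d1" for n1 d1 c1
  proof -
    obtain n' d' c' where r: "circ_coloring E (int n') (int d') c'" "n' \<le> max 2 (card V)"
      "n' \<ge> 2 * d'" "d' \<ge> 1" "n' * d1 \<le> n1 * d'" using less.IH[OF *(1-4)] by blast
    have "n' * d * d1 \<le> n1 * d * d'" using mult_right_mono[OF r(5), of d] by (simp add: ac_simps)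
    also have "\<dots> \<le> n * d1 * d'" using mult_right_mono[OF *(5), of d'] by (simp add: ac_simps)
    finally have "(n' * d) * d1 \<le> (n * d') * d1" by (simp add: ac_simps)
    then have "n' * d \<le> n * d'" using *(4) by simp
    then show ?thesis using r by blast
  qed
  show ?case
  proof (cases "n \<le> max 2 (card V)")
    case True
    then show ?thesis using less.prems by blast
  next
    case big: False
    show ?thesis
    proof (cases "coprime n d")
      case False
      define g where "g = gcd n d"
      have "g \<noteq> 0" "g \<noteq> 1" using False less.prems by (auto simp: g_def coprime_iff_gcd_eq_1)
      then have g: "g > 1" by simp
      obtain n1 d1 where nd: "n = n1 * g" "d = d1 * g"
        by (metis g_def gcd_dvd1 gcd_dvd2 dvd_def mult.commute)
      have pos: "n1 > 0" "d1 > 0" using nd less.prems by (auto intro: gr0I)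
      have "n1 < n" using nd g pos by simp
      moreover have "circ_coloring E (int n1) (int d1) (\<lambda>v. (c v * int n1) div int n)"
        using less.prems pos by (intro circ_coloring_mono[OF less.prems(1) assms(1)]) (auto simp: nd)
      moreover have "n1 \<ge> 2 * d1" using less.prems nd g by (simp add: mult.assoc[symmetric])
      ultimately show ?thesis using pos by (intro step) (auto simp: nd)
    next
      case True
      then obtain n' d' where r: "n * d' = n' * d + 1" "n' < n" "d' \<ge> 1" "n' \<ge> 2 * d'"
        using ex_inverse_mod_range[of n d] less.prems(2,3) big by (auto simp: max_def split: if_splits)
      have "card ((\<lambda>v. c v mod int n) ` V) \<le> card V" by (rule card_image_le[OF assms(3)])
      also have "\<dots> < card {0..<int n}" using big by simp
      finally have "\<not> {0..<int n} \<subseteq> (\<lambda>v. c v mod int n) ` V"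
        using assms(3) by (meson card_mono finite_imageI not_le)
      then obtain m where m: "m \<in> {0..<int n}" "m \<notin> (\<lambda>v. c v mod int n) ` V" by blast
      \<comment> \<open>Subtracting \<open>m\<close> turns the missed residue into 0, the only one
        at which rounding can fail.\<close>
      have av: "\<not> int n dvd c u - m" if "u \<in> Field E" for u
      proof
        assume "int n dvd c u - m"
        then have "c u mod int n = m mod int n" by (simp add: mod_eq_dvd_iff)
        also have "\<dots> = m" using m by simp
        finally show False using m that assms(2) by (auto simp: Field_def)
      qed
      have cc: "circ_coloring E n d (\<lambda>v. c v - m)"
        using less.prems(1) by (simp add: circ_coloring_def)
      have "int n * int d' = int n' * int d + 1" using r(1) by (metis of_nat_1 of_nat_add of_nat_mult)
      then have "circ_coloring E (int n') (int d') (\<lambda>v. ((c v - m) * int n') div int n)"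
        using less.prems(2,3) r(3,4) av by (intro circ_coloring_avoid[OF cc assms(1)]) auto
      then show ?thesis using r by (intro step) auto
    qed
  qed
qed

subsection \<open>Graph powers, subdivisions and chromatic numbers\<close>

lemma relpow_sym: "sym E \<Longrightarrow> sym (E ^^ k)"
proof (induction k)
  case (Suc k)
  show ?case
  proof (rule symI)
    fix x y assume "(x, y) \<in> E ^^ Suc k"
    then obtain z where "(x, z) \<in> E ^^ k" "(z, y) \<in> E" by auto
    then have "(z, x) \<in> E ^^ k" "(y, z) \<in> E" using Suc by (auto dest: symD)
    then show "(y, x) \<in> E ^^ Suc k" by (rule relpow_Suc_I2[rotated])
  qed
qed (auto simp: sym_def)

text \<open>Traversing the last edge back and forth lengthens a walk by 2.\<close>

lemma relpow_odd_mono: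
  assumes "sym E" "i \<le> r"
  shows "E ^^ (2 * i + 1) \<subseteq> E ^^ (2 * r + 1)"
  using assms(2)
proof (induction r rule: dec_induct)
  case (step r)
  show ?case
  proof safe
    fix x y assume "(x, y) \<in> E ^^ (2 * i + 1)"
    then have *: "(x, y) \<in> E ^^ (2 * r + 1)" using step by blast
    then obtain z where "(z, y) \<in> E" by auto
    then have "(x, y) \<in> E ^^ Suc (Suc (2 * r + 1))"
      using * assms(1) by (meson relpow_Suc_I symD)
    then show "(x, y) \<in> E ^^ (2 * Suc r + 1)" by simp
  qed
qed auto

text \<open>For \<open>k = 0\<close> the relation power is the identity on the whole type, whereas
  an empty walk starts at a vertex; hence the conjunct on \<open>u\<close>.\<close>

lemma (in pair_wf_digraph) awalk_length_iff_relpow: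
  "(\<exists>p. awalk u p v \<and> length p = k) \<longleftrightarrow> u \<in> pverts G \<and> (u, v) \<in> parcs G ^^ k"
proof (induction k arbitrary: u)
  case 0
  then show ?case by (auto simp: awalk_Nil_iff)
next
  case (Suc k)
  have "(\<exists>p. awalk u p v \<and> length p = Suc k) \<longleftrightarrow>
    (\<exists>w. (u, w) \<in> parcs G \<and> (\<exists>p. awalk w p v \<and> length p = k))"
    by (auto simp: length_Suc_conv awalk_Cons_iff) (metis fst_conv snd_conv awalk_Cons_iff length_Cons with_proj_simps)+
  then show ?case
    unfolding Suc using relpow_Suc_D2[of u v k "parcs G"] relpow_Suc_I2[of u _ "parcs G" v k]
    by (blast dest: in_arcsD1 in_arcsD2)
qed

lemma parcs_graph_power:
  assumes "pair_wf_digraph G"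
  shows "parcs (graph_power G k) = parcs G ^^ k \<inter> pverts G \<times> UNIV"
  using pair_wf_digraph.awalk_length_iff_relpow[OF assms] by (auto simp: graph_power_def)

lemma proper_coloring_mono:
  "proper_coloring G j c \<Longrightarrow> j \<le> k \<Longrightarrow> proper_coloring G k c"
  by (fastforce simp: proper_coloring_def)

text \<open>A finite value excludes the empty set of colour numbers, and the infimum of a nonempty
  set in \<open>enat\<close> is attained.\<close>

lemma chromatic_number_eq_iff:
  "chromatic_number G = enat k \<longleftrightarrow>
    (\<exists>c. proper_coloring G k c) \<and> (\<forall>j<k. \<nexists>c. proper_coloring G j c)"
proof
  let ?S = "{enat k |k. \<exists>c. proper_coloring G k c}"
  {
    assume k: "chromatic_number G = enat k"
    then have "?S \<noteq> {}" unfolding chromatic_number_def Inf_enat_def by (metis enat.distinct(1))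
    then obtain x where "x \<in> ?S" by blast
    then have "Inf ?S \<in> ?S" unfolding Inf_enat_def using LeastI[of "\<lambda>y. y \<in> ?S" x] by auto
    moreover have "enat j \<notin> ?S" if "j < k" for j
      using Inf_lower[of "enat j" ?S] k that by (auto simp: chromatic_number_def)
    ultimately show "(\<exists>c. proper_coloring G k c) \<and> (\<forall>j<k. \<nexists>c. proper_coloring G j c)"
      using k unfolding chromatic_number_def by auto
  }
  {
    assume k: "(\<exists>c. proper_coloring G k c) \<and> (\<forall>j<k. \<nexists>c. proper_coloring G j c)"
    show "chromatic_number G = enat k"
      unfolding chromatic_number_def
    proof (rule antisym)
      show "Inf ?S \<le> enat k" using k by (auto intro!: Inf_lower)
      show "enat k \<le> Inf ?S"
      proof (rule Inf_greatest)
        fix x assume "x \<in> ?S"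
        then obtain j c where j: "x = enat j" "proper_coloring G j c" by blast
        then have "\<not> j < k" using k by blast
        then show "enat k \<le> x" using j by simp
      qed
    qed
  }
qed

lemma bipartite_if_2_colorable:
  assumes "pair_wf_digraph G" "proper_coloring G 2 c"
  shows "bipartite G"
proof -
  interpret pair_wf_digraph G by fact
  let ?A = "\<lambda>i. {v \<in> pverts G. c v = i}"
  have c2: "c v = 0 \<or> c v = 1" if "v \<in> pverts G" for v
  proof -
    have "c v < 2" using assms(2) that by (auto simp: proper_coloring_def)
    then show ?thesis by linarith
  qed
  have "(u, v) \<in> ?A 0 \<times> ?A 1 \<union> ?A 1 \<times> ?A 0" if "(u, v) \<in> parcs G" for u v
  proof -
    have "u \<in> pverts G" "v \<in> pverts G" "c u \<noteq> c v"
      using that assms(2) in_arcsD1 in_arcsD2 by (auto simp: proper_coloring_def)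
    then show ?thesis using c2[of u] c2[of v] by auto
  qed
  then have "parcs G \<subseteq> ?A 0 \<times> ?A 1 \<union> ?A 1 \<times> ?A 0" by (rule subrelI)
  moreover have "?A 0 \<union> ?A 1 = pverts G" using c2 by auto
  ultimately show ?thesis unfolding bipartite_def by (intro exI[of _ "?A 0"] exI[of _ "?A 1"]) auto
qed

lemma subdiv_point_relpow:
  assumes "(u, v) \<in> parcs G" "i \<le> t"
  shows "(Inl u, subdiv_point t u v i) \<in> parcs (subdiv t G) ^^ i"
  using assms(2)
proof (induction i)
  case (Suc i)
  then have "(subdiv_point t u v i, subdiv_point t u v (Suc i)) \<in> parcs (subdiv t G)"
    using assms(1) Suc.prems unfolding subdiv_def by (simp add: Suc_le_eq) blast
  then show ?case using Suc by auto
qed (simp add: subdiv_point_def)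

lemma subdiv_edge_relpow:
  assumes "(u, v) \<in> parcs G" "t \<ge> 1"
  shows "(Inl u, Inl v) \<in> parcs (subdiv t G) ^^ t"
  using subdiv_point_relpow[OF assms(1) order.refl, of t] assms(2) by (simp add: subdiv_point_def)

lemma sym_parcs: "pair_graph G \<Longrightarrow> sym (parcs G)"
proof -
  assume "pair_graph G"
  then interpret pair_graph G .
  show ?thesis by (auto intro: symI arcs_symmetric)
qed

text \<open>For odd \<open>p\<close> every edge of the subdivision is also joined by a walk of
  length \<open>p\<close>, so a 2-colouring of the power is one of the subdivision. Colours
  alternate along its paths of odd length \<open>q\<close>, so the original vertices of
  \<open>G\<close> are properly 2-coloured as well.\<close>

lemma frac_power_not_2_colorable:
  assumes "pair_graph G" "\<not> bipartite G" "odd p" "odd q"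
  shows "\<nexists>c. proper_coloring (frac_power G p q) 2 c"
proof
  assume "\<exists>c. proper_coloring (frac_power G p q) 2 c"
  then obtain c where c: "proper_coloring (frac_power G p q) 2 c" by blast
  interpret G: pair_graph G by fact
  have q: "q \<ge> 1" using assms(4) by (cases q) auto
  interpret S: pair_graph "subdiv q G" by (rule pair_graph_subdiv[OF assms(1) q])
  let ?E = "parcs (subdiv q G)"
  have sym: "sym ?E" by (rule sym_parcs) unfold_locales
  obtain r where r: "p = 2 * r + 1" using assms(3) by (auto elim: oddE)
  have ed: "c x \<noteq> c y" if "(x, y) \<in> ?E" for x y
  proof -
    have "(x, y) \<in> ?E ^^ p" using relpow_odd_mono[OF sym, of 0 r] that unfolding r by auto
    then have "(x, y) \<in> parcs (frac_power G p q)"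
      using that S.in_arcsD1 by (simp add: frac_power_def parcs_graph_power[OF S.pair_wf_digraph_axioms])
    then show ?thesis using c by (auto simp: proper_coloring_def)
  qed
  have lt: "c x < 2" if "x \<in> pverts (subdiv q G)" for x
    using c that by (auto simp: proper_coloring_def frac_power_def graph_power_def)
  have par: "c y < 2 \<and> (c x = c y \<longleftrightarrow> even m)" if "(x, y) \<in> ?E ^^ m" "c x < 2" for x y m
    using that
  proof (induction m arbitrary: y)
    case (Suc m)
    then obtain z where z: "(x, z) \<in> ?E ^^ m" "(z, y) \<in> ?E" by auto
    have "c y < 2" "c z \<noteq> c y" using lt ed z S.in_arcsD2 by auto
    then show ?case using Suc.IH[OF z(1) Suc.prems(2)] Suc.prems by auto
  qed auto
  have "proper_coloring G 2 (\<lambda>v. c (Inl v))"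
    unfolding proper_coloring_def
  proof safe
    fix v assume "v \<in> pverts G"
    then show "c (Inl v) < 2" by (intro lt) (auto simp: subdiv_def)
  next
    fix u v assume uv: "(u, v) \<in> parcs G" "c (Inl u) = c (Inl v)"
    have "c (Inl u) < 2" using uv G.in_arcsD1 by (intro lt) (auto simp: subdiv_def)
    then show False using par[OF subdiv_edge_relpow[OF uv(1) q]] uv assms(4) by auto
  qed
  then show False using assms(2) bipartite_if_2_colorable[OF G.pair_wf_digraph_axioms] by blast
qed

subsection \<open>Almost antipodal maps\<close>

text \<open>The circle has length \<open>2 * h\<close>, and \<open>w\<close> bounds the deviation of
  an edge from a pair of antipodes. The deviation is an integer rather than a residue so that
  deviations can be added along walks.\<close>

definition antipodal :: "('a \<times> 'a) set \<Rightarrow> int \<Rightarrow> int \<Rightarrow> ('a \<Rightarrow> int) \<Rightarrow> bool" where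
  "antipodal E h w c \<longleftrightarrow>
     (\<forall>(u, v) \<in> E. \<exists>e z. \<bar>e\<bar> \<le> w \<and> c v - c u = h + e + z * (2 * h))"

text \<open>Shifting by \<open>h\<close> takes deviations between \<open>-w\<close> and
  \<open>w\<close> to gaps between \<open>h - w\<close> and \<open>2 * h - (h - w)\<close>.\<close>

lemma antipodal_iff_circ_coloring:
  assumes "sym E" "0 \<le> w" "w < h"
  shows "antipodal E h w c \<longleftrightarrow> circ_coloring E (2 * h) (h - w) c"
proof
  assume A: "antipodal E h w c"
  show "circ_coloring E (2 * h) (h - w) c"
  proof (rule circ_coloringI)
    fix u v assume "(u, v) \<in> E"
    then obtain e z where e: "\<bar>e\<bar> \<le> w" "c v - c u = h + e + z * (2 * h)"
      using A unfolding antipodal_def by blast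
    then show "\<exists>e z. c v - c u = e + z * (2 * h) \<and> h - w \<le> e \<and> e < 2 * h"
      using assms by (intro exI[of _ "h + e"] exI[of _ z]) auto
  qed (use assms in simp)
next
  assume C: "circ_coloring E (2 * h) (h - w) c"
  show "antipodal E h w c"
    unfolding antipodal_def
  proof safe
    fix u v assume "(u, v) \<in> E"
    then obtain e z where e: "c v - c u = e + z * (2 * h)" "h - w \<le> e" "e \<le> 2 * h - (h - w)"
      using circ_coloringE[OF C assms(1), of u v] assms by auto
    then show "\<exists>e z. \<bar>e\<bar> \<le> w \<and> c v - c u = h + e + z * (2 * h)"
      by (intro exI[of _ "e - h"] exI[of _ z]) auto
  qed
qed

text \<open>Deviations add up along a walk, and for odd \<open>m\<close> the sum of \<open>m\<close>
  half turns is again a half turn modulo \<open>2 * h\<close>.\<close>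

lemma antipodal_relpow:
  assumes "antipodal E h w c" "odd m"
  shows "antipodal (E ^^ m) h (w * int m) c"
proof -
  have *: "\<exists>e z. \<bar>e\<bar> \<le> w * int m \<and> c v - c u = h * int m + e + z * (2 * h)"
    if "(u, v) \<in> E ^^ m" for u v and m :: nat
    using that
  proof (induction m arbitrary: v)
    case 0
    then show ?case by (auto intro!: exI[of _ 0])
  next
    case (Suc m)
    then obtain x where x: "(u, x) \<in> E ^^ m" "(x, v) \<in> E" by auto
    obtain e z where e: "\<bar>e\<bar> \<le> w * int m" "c x - c u = h * int m + e + z * (2 * h)"
      using Suc.IH[OF x(1)] by blast
    obtain e' z' where e': "\<bar>e'\<bar> \<le> w" "c v - c x = h + e' + z' * (2 * h)"
      using assms(1) x(2) unfolding antipodal_def by blast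
    have "\<bar>e + e'\<bar> \<le> w * int (Suc m)" using e(1) e'(1) by (simp add: algebra_simps)
    moreover have "c v - c u = h * int (Suc m) + (e + e') + (z + z') * (2 * h)"
      using e(2) e'(2) by (simp add: algebra_simps)
    ultimately show ?case by blast
  qed
  obtain k where k: "m = 2 * k + 1" using assms(2) by (rule oddE)
  show ?thesis
    unfolding antipodal_def
  proof safe
    fix u v assume "(u, v) \<in> E ^^ m"
    then obtain e z where e: "\<bar>e\<bar> \<le> w * int m" "c v - c u = h * int m + e + z * (2 * h)"
      using * by blast
    have "h * int m = h + int k * (2 * h)" unfolding k by (simp add: algebra_simps)
    then have "c v - c u = h + e + (z + int k) * (2 * h)" using e(2) by (simp add: algebra_simps)
    then show "\<exists>e z. \<bar>e\<bar> \<le> w * int m \<and> c v - c u = h + e + z * (2 * h)" using e(1) by blast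
  qed
qed

text \<open>The circle of length \<open>6 * p\<close> is cut into three arcs of length
  \<open>2 * p\<close>. Points of one arc are less than \<open>2 * p\<close> apart, while the ends
  of an edge are at least \<open>3 * p - p\<close> apart in either direction.\<close>

lemma antipodal_imp_3_coloring:
  assumes "antipodal E (3 * p) p c" "p > 0" "(u, v) \<in> E"
  shows "(c u mod (6 * p)) div (2 * p) \<noteq> (c v mod (6 * p)) div (2 * p)"
proof
  define a b where "a = c u mod (6 * p)" and "b = c v mod (6 * p)"
  assume "(c u mod (6 * p)) div (2 * p) = (c v mod (6 * p)) div (2 * p)"
  then have eq: "a div (2 * p) = b div (2 * p)" by (simp add: a_def b_def)
  have "a = (2 * p) * (a div (2 * p)) + a mod (2 * p)" "b = (2 * p) * (b div (2 * p)) + b mod (2 * p)"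
    by simp_all
  moreover have "0 \<le> a mod (2 * p)" "a mod (2 * p) < 2 * p" "0 \<le> b mod (2 * p)" "b mod (2 * p) < 2 * p"
    using assms(2) by simp_all
  ultimately have ab: "\<bar>b - a\<bar> < 2 * p" unfolding eq by linarith
  obtain e z where e: "\<bar>e\<bar> \<le> p" "c v - c u = 3 * p + e + z * (2 * (3 * p))"
    using assms(1,3) unfolding antipodal_def by blast
  define k where "k = z + c u div (6 * p) - c v div (6 * p)"
  have "c u = (6 * p) * (c u div (6 * p)) + a" "c v = (6 * p) * (c v div (6 * p)) + b"
    by (simp_all add: a_def b_def)
  then have d: "b - a = 3 * p + e + k * (6 * p)" using e(2) unfolding k_def by (simp add: algebra_simps)
  consider "k \<ge> 0" | "k \<le> -1" by linarith
  then show False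
  proof cases
    case 1
    then have "k * (6 * p) \<ge> 0" using assms(2) by simp
    then show False using d ab e(1) by linarith
  next
    case 2
    then have "k * (6 * p) \<le> -1 * (6 * p)" using assms(2) by (intro mult_right_mono) auto
    then show False using d ab e(1) by linarith
  qed
qed

text \<open>\<open>(2 x + q) div (2 q)\<close> is \<open>x / q\<close> rounded to the nearest integer. For odd \<open>q\<close> there are no ties,
  hence the symmetry.\<close>

lemma round_div_odd_reflect:
  fixes q :: int
  assumes "odd q" "q > 0"
  shows "(2 * (e * q - x) + q) div (2 * q) = e - (2 * x + q) div (2 * q)"
proof -
  define k s where "k = (2 * x + q) div (2 * q)" and "s = (2 * x + q) mod (2 * q)"
  have ks: "2 * x + q = 2 * q * k + s" by (simp add: k_def s_def)
  have s: "0 \<le> s" "s < 2 * q" using assms(2) by (simp_all add: s_def)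
  have "odd (2 * x + q)" using assms(1) by simp
  then have "odd s" unfolding ks by simp
  then have "s \<noteq> 0" by auto
  have "2 * (e * q - x) + q = (2 * q - s) + (e - k) * (2 * q)" using ks by (simp add: algebra_simps)
  then have "(2 * (e * q - x) + q) div (2 * q) = (2 * q - s) div (2 * q) + (e - k)"
    using assms(2) by (simp only: div_mult_self1)
  also have "(2 * q - s) div (2 * q) = 0" using s \<open>s \<noteq> 0\<close> by (intro div_pos_pos_trivial) auto
  finally show ?thesis by (simp add: k_def)
qed

lemma round_div_step:
  fixes q :: int
  assumes "q > 0" "\<bar>e\<bar> \<le> q"
  shows "\<bar>(2 * (x + e) + q) div (2 * q) - (2 * x + q) div (2 * q)\<bar> \<le> 1"
proof -
  have "(2 * (x + e) + q) div (2 * q) \<le> (2 * x + q + 1 * (2 * q)) div (2 * q)"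
    using assms by (intro zdiv_mono1) auto
  also have "\<dots> = (2 * x + q) div (2 * q) + 1" using assms(1) by (subst div_mult_self1) auto
  finally have 1: "(2 * (x + e) + q) div (2 * q) \<le> (2 * x + q) div (2 * q) + 1" .
  have "(2 * x + q + (-1) * (2 * q)) div (2 * q) \<le> (2 * (x + e) + q) div (2 * q)"
    using assms by (intro zdiv_mono1) auto
  moreover have "(2 * x + q + (-1) * (2 * q)) div (2 * q) = (2 * x + q) div (2 * q) - 1"
    using assms(1) by (subst div_mult_self1) auto
  ultimately show ?thesis using 1 by linarith
qed

text \<open>The error \<open>e u v\<close> of an edge is spread evenly along its path: at distance
  \<open>i\<close> from \<open>u\<close>, the map has gained \<open>i\<close> half turns and the
  rounded share of the error, which changes by at most 1 per step.\<close>

lemma antipodal_subdiv: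
  assumes "pair_graph G" "odd q"
    and e: "\<And>u v. (u, v) \<in> parcs G \<Longrightarrow>
      e v u = - e u v \<and> \<bar>e u v\<bar> \<le> int q \<and> (\<exists>z. c v - c u = h + e u v + z * (2 * h))"
  shows "\<exists>g. antipodal (parcs (subdiv q G)) h 1 g"
proof -
  have q: "q > 0" using assms(2) by (cases q) auto
  interpret pair_graph G by fact
  define \<rho> where "\<rho> x = (2 * x + int q) div (2 * int q)" for x
  define F where "F u v i = c u + h * int i + \<rho> (e u v * int i)" for u v and i :: nat
  \<comment> \<open>An inner vertex is a set of two descriptions and \<open>SOME\<close> picks one
    of them; by \<open>Frev\<close> below, either choice gives the same point of the circle.\<close>
  define g where "g x = (case x of Inl u \<Rightarrow> c u | Inr S \<Rightarrow> (case SOME y. y \<in> S of (u, v, i) \<Rightarrow> F u v i))"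
    for x :: "'a + ('a \<times> 'a \<times> nat) set"
  have \<rho>0: "\<rho> 0 = 0" using q by (simp add: \<rho>_def)
  have \<rho>r: "\<rho> (a * int q - x) = a - \<rho> x" for a x
    using round_div_odd_reflect[of "int q" a x] assms(2) q by (simp add: \<rho>_def)
  have \<rho>m: "\<rho> (- x) = - \<rho> x" for x using \<rho>r[of 0 x] by simp
  have Frev: "\<exists>z. F v u (q - i) = F u v i + z * (2 * h)" if uv: "(u, v) \<in> parcs G" and i: "i \<le> q" for u v i
  proof -
    obtain z where z: "c v - c u = h + e u v + z * (2 * h)" and ev: "e v u = - e u v" using e[OF uv] by blast
    have "e v u * int (q - i) = - (e u v * int q - e u v * int i)"
      unfolding ev using i by (simp add: of_nat_diff algebra_simps)
    then have "\<rho> (e v u * int (q - i)) = \<rho> (e u v * int i) - e u v" by (simp only: \<rho>m \<rho>r)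
    then have F: "F v u (q - i) = F u v i + h + z * (2 * h) + h * (int q - 2 * int i)"
      unfolding F_def using z i by (simp add: of_nat_diff algebra_simps)
    \<comment> \<open>Oddness of \<open>q\<close> makes \<open>h + h * (q - 2 * i)\<close> a
      multiple of the full turn \<open>2 * h\<close>.\<close>
    obtain k where k: "q = 2 * k + 1" using assms(2) by (rule oddE)
    have "F v u (q - i) = F u v i + (z + int k + 1 - int i) * (2 * h)"
      unfolding F unfolding k by (simp add: algebra_simps)
    then show ?thesis by blast
  qed
  have gF: "\<exists>z. g (subdiv_point q u v i) = F u v i + z * (2 * h)" if uv: "(u, v) \<in> parcs G" and i: "i \<le> q" for u v i
  proof -
    have F0: "F u v 0 = c u" for u v by (simp add: F_def \<rho>0)
    consider "i = 0" | "i = q" | "0 < i" "i < q" using i by linarith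
    then show ?thesis
    proof cases
      case 1
      then show ?thesis by (auto simp: subdiv_point_def g_def F0 intro: exI[of _ 0])
    next
      \<comment> \<open>Here the point is \<open>v\<close> itself, with value
        \<open>c v = F v u 0\<close>, so the end of the path is compared with its beginning as read
        from \<open>v\<close>.\<close>
      case 2
      obtain z where "F v u (q - q) = F u v q + z * (2 * h)" using Frev[OF uv, of q] by blast
      then have "g (subdiv_point q u v i) = F u v i + z * (2 * h)"
        using 2 q by (simp add: subdiv_point_def g_def F0)
      then show ?thesis by blast
    next
      case 3
      let ?S = "{(u, v, i), (v, u, q - i)}"
      have "(SOME y. y \<in> ?S) \<in> ?S" by (rule someI[of _ "(u, v, i)"]) simp
      then have "g (Inr ?S) = F u v i \<or> g (Inr ?S) = F v u (q - i)"
        unfolding g_def by auto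
      moreover have "subdiv_point q u v i = Inr ?S" using 3 by (simp add: subdiv_point_def)
      ultimately show ?thesis using Frev[OF uv i] by (metis add.right_neutral mult_zero_left)
    qed
  qed
  have "antipodal (parcs (subdiv q G)) h 1 g"
    unfolding antipodal_def
  proof safe
    fix x y assume "(x, y) \<in> parcs (subdiv q G)"
    then obtain u v i where uv: "(u, v) \<in> parcs G" "i < q"
      and xy: "x = subdiv_point q u v i" "y = subdiv_point q u v (i + 1)"
      unfolding subdiv_def by auto
    obtain z1 where z1: "g x = F u v i + z1 * (2 * h)" using gF[OF uv(1)] uv(2) xy by fastforce
    obtain z2 where z2: "g y = F u v (i + 1) + z2 * (2 * h)" using gF[OF uv(1), of "i + 1"] uv(2) xy by fastforce
    define d where "d = \<rho> (e u v * int i + e u v) - \<rho> (e u v * int i)"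
    have d: "\<bar>d\<bar> \<le> 1"
      unfolding d_def \<rho>_def using round_div_step[of "int q" "e u v" "e u v * int i"] e[OF uv(1)] q by simp
    have "g y - g x = h + d + (z2 - z1) * (2 * h)"
      unfolding z1 z2 F_def d_def by (simp add: algebra_simps)
    then show "\<exists>e z. \<bar>e\<bar> \<le> 1 \<and> g y - g x = h + e + z * (2 * h)" using d by blast
  qed
  then show ?thesis by blast
qed

text \<open>The position of \<open>u\<close> on the cycle is read off from the colours \<open>A u i\<close> seen by walks of length \<open>i\<close>
  from \<open>u\<close>. The first time \<open>\<tau> u\<close> at which two colours are seen is the distance to the nearest border
  between colour classes (or to the antipode of one, if \<open>\<tau> u\<close> is odd), the colour \<open>z u\<close> not seen at
  time \<open>\<tau> u\<close> identifies that border, and the colour \<open>s u\<close> seen before tells the side.\<close>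

lemma three_coloring_odd_power_imp_antipodal:
  fixes E :: "('a \<times> 'a) set" and f :: "'a \<Rightarrow> nat"
  assumes sym: "sym E" and p: "p = 2 * r + 1"
    and f3: "\<And>u. f u < 3" and ff: "\<And>u v. (u, v) \<in> E ^^ p \<Longrightarrow> f u \<noteq> f v"
  shows "\<exists>c. antipodal E (3 * int p) 1 c"
proof -

  \<comment> \<open>Colour sets seen from a vertex\<close>
  define N where "N u i = f ` ((E ^^ i) `` {u})" for u i
  \<comment> \<open>At time \<open>r + 1\<close> the set is replaced by the complement of
    \<open>N u r\<close>. It contains what any neighbour sees at time \<open>r\<close>, and it has
    two elements if \<open>N u r\<close> has one, so two colours are seen by time
    \<open>r + 1\<close> at the latest.\<close>
  define A where "A u i = (if i \<le> r then N u i else {..<3} - N u r)" for u i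
  have N3: "N u i \<subseteq> {..<3}" for u i using f3 by (auto simp: N_def)
  have A3: "A u i \<subseteq> {..<3}" for u i using N3 by (auto simp: A_def)
  have finA: "finite (A u i)" for u i by (rule finite_subset[OF A3]) simp
  \<comment> \<open>Walks of length \<open>i\<close> from both ends of an edge combine to a walk of
    odd length \<open>2 * i + 1\<close> \<le> \<open>p\<close>, which extends to length
    \<open>p\<close>.\<close>
  have disjN: "N u i \<inter> N v i = {}" if "(u, v) \<in> E" "i \<le> r" for u v i
  proof -
    have "f x \<noteq> f y" if x: "(u, x) \<in> E ^^ i" and y: "(v, y) \<in> E ^^ i" for x y
    proof -
      have "(x, u) \<in> E ^^ i" using x relpow_sym[OF sym] by (auto dest: symD)
      then have "(x, v) \<in> E ^^ Suc i" using \<open>(u, v) \<in> E\<close> by auto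
      then have "(x, y) \<in> E ^^ (Suc i + i)" using y unfolding relpow_add by blast
      then have "(x, y) \<in> E ^^ (2 * i + 1)" by (simp add: mult_2)
      then have "(x, y) \<in> E ^^ p" using relpow_odd_mono[OF sym \<open>i \<le> r\<close>] unfolding p by blast
      then show ?thesis by (rule ff)
    qed
    then show ?thesis unfolding N_def by auto
  qed
  have disj: "A u i \<inter> A v i = {}" if "(u, v) \<in> E" "i \<le> r" for u v i
    using disjN that by (simp add: A_def)
  have step: "A u i \<subseteq> A v (Suc i)" if uv: "(u, v) \<in> E" "i \<le> r" for u v i
  proof (cases "i = r")
    case True
    then show ?thesis using disjN[OF uv(1), of r] N3[of u r] by (auto simp: A_def)
  next
    case False
    have "(v, u) \<in> E" using uv sym by (auto dest: symD)
    then have "(E ^^ i) `` {u} \<subseteq> (E ^^ Suc i) `` {v}" using relpow_Suc_I2[of v u E] by blast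
    then show ?thesis using False uv(2) by (simp add: A_def N_def image_mono)
  qed
  have nonempty: "A u i \<noteq> {}" if "u \<in> Domain E" "i \<le> r" for u i
    using that
  proof (induction i arbitrary: u)
    case 0
    then show ?case by (simp add: A_def N_def)
  next
    case (Suc i)
    then obtain v where v: "(u, v) \<in> E" by auto
    then have "(v, u) \<in> E" using sym by (auto dest: symD)
    then show ?case using Suc.IH[of v] Suc.prems step[of v u i] by auto
  qed
  have le2: "card (A u i) \<le> 2" if u: "u \<in> Domain E" and i: "i \<le> Suc r" for u i
  proof -
    have "\<exists>B. B \<noteq> {} \<and> B \<subseteq> {..<3} \<and> A u i \<inter> B = {}"
    proof (cases "i \<le> r")
      case True
      obtain v where v: "(u, v) \<in> E" using u by auto
      then have "v \<in> Domain E" using sym by (auto dest: symD)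
      then show ?thesis using nonempty[of v i] disj[OF v, of i] A3[of v i] True
        by (intro exI[of _ "A v i"]) auto
    next
      case False
      then show ?thesis using nonempty[OF u, of r] N3[of u r] by (intro exI[of _ "N u r"]) (auto simp: A_def)
    qed
    then obtain b where "b \<in> {..<3}" "b \<notin> A u i" by blast
    then have "A u i \<subset> {..<3}" using A3 by blast
    then have "card (A u i) < card {..<3::nat}" by (intro psubset_card_mono) auto
    then show ?thesis by simp
  qed
  have ex2: "\<exists>i\<le>Suc r. card (A u i) = 2" if u: "u \<in> Domain E" for u
  proof (cases "card (A u r) = 2")
    case True
    then show ?thesis by (intro exI[of _ r]) simp
  next
    case False
    have "card (A u r) \<noteq> 0" using nonempty[OF u, of r] finA by simp
    then have "card (A u r) = 1" using le2[OF u, of r] False by auto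
    then have "card (A u (Suc r)) = 2" using N3[of u r]
      by (simp add: A_def card_Diff_subset finite_subset[OF N3])
    then show ?thesis by blast
  qed

  \<comment> \<open>Distance to the nearest border, missing colour and side\<close>
  define \<tau> where "\<tau> u = (LEAST i. card (A u i) = 2)" for u
  have \<tau>: "card (A u (\<tau> u)) = 2" "\<tau> u \<le> Suc r" if u: "u \<in> Domain E" for u
  proof -
    obtain i where i: "i \<le> Suc r" "card (A u i) = 2" using ex2[OF u] by blast
    show "card (A u (\<tau> u)) = 2" unfolding \<tau>_def by (rule LeastI[of _ i]) (rule i)
    show "\<tau> u \<le> Suc r" unfolding \<tau>_def using Least_le[of "\<lambda>i. card (A u i) = 2", OF i(2)] i(1) by linarith
  qed
  have \<tau>le: "\<tau> u \<le> i" if "card (A u i) = 2" for u i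
    unfolding \<tau>_def using that by (rule Least_le)
  have one: "card (A u i) = 1" if "u \<in> Domain E" "i < \<tau> u" for u i
  proof -
    have i: "i \<le> r" using \<tau>(2)[OF that(1)] that(2) by simp
    have "card (A u i) \<noteq> 2" using \<tau>le that(2) by (meson not_le)
    moreover have "card (A u i) \<noteq> 0" using nonempty[OF that(1) i] finA by simp
    ultimately show ?thesis using le2[OF that(1), of i] i by linarith
  qed
  have \<tau>pos: "\<tau> u \<ge> 1" if "u \<in> Domain E" for u
  proof (rule ccontr)
    assume "\<not> \<tau> u \<ge> 1"
    then have "\<tau> u = 0" by simp
    then have "card (A u 0) = 2" using \<tau>(1)[OF that] by simp
    then show False by (simp add: A_def N_def)
  qed
  define z where "z u = (SOME z. z < 3 \<and> z \<notin> A u (\<tau> u))" for u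
  have z: "z u < 3" "A u (\<tau> u) = {..<3} - {z u}" if u: "u \<in> Domain E" for u
  proof -
    have "card (A u (\<tau> u)) \<noteq> card {..<3::nat}" using \<tau>(1)[OF u] by simp
    then have "A u (\<tau> u) \<noteq> {..<3}" by metis
    then have "\<exists>z. z < 3 \<and> z \<notin> A u (\<tau> u)" using A3[of u "\<tau> u"] by blast
    then have *: "z u < 3 \<and> z u \<notin> A u (\<tau> u)" unfolding z_def by (rule someI_ex)
    then show "z u < 3" by simp
    show "A u (\<tau> u) = {..<3} - {z u}"
    proof (rule card_subset_eq)
      show "A u (\<tau> u) \<subseteq> {..<3} - {z u}" using * A3[of u "\<tau> u"] by blast
      show "card (A u (\<tau> u)) = card ({..<3} - {z u})" using * \<tau>(1)[OF u] by simp
    qed simp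
  qed
  \<comment> \<open>For \<tau> u = 1 the truncated subtraction gives time 0; the side is then
    harmless, as its factor \<tau> u - 1 in \<open>c\<close> vanishes.\<close>
  define s where "s u = (SOME x. x \<in> A u (\<tau> u - 2))" for u
  have s: "A u (\<tau> u - 2) = {s u}" if u: "u \<in> Domain E" for u
  proof -
    have "card (A u (\<tau> u - 2)) = 1" using one[OF u, of "\<tau> u - 2"] \<tau>pos[OF u] by simp
    then obtain x where "A u (\<tau> u - 2) = {x}" by (rule card_1_singletonE)
    then show ?thesis by (simp add: s_def)
  qed
  define D :: "nat \<Rightarrow> nat \<Rightarrow> int" where "D z s = (if s = (z + 1) mod 3 then - 1 else 1)" for z s
  \<comment> \<open>Colour \<open>j\<close> occupies the arc from \<open>2 * p * j\<close> to
    \<open>2 * p * (j + 1)\<close> of the circle of length \<open>6 * p\<close>, so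
    \<open>2 * p * (z + 2)\<close> is modulo \<open>6 * p\<close> the border between the two colours
    other than \<open>z\<close>. The term with \<open>3 * p\<close> moves to its antipode for odd
    \<tau>, and the vertex is placed \<tau> - 1 away, in the direction \<open>D\<close> of the side
    \<open>s\<close>.\<close>
  define c where "c u = 2 * int p * (int (z u) + 2) + 3 * int p * int (\<tau> u) + D (z u) (s u) * (int (\<tau> u) - 1)" for u
  define R where "R u v \<longleftrightarrow> (\<exists>e k. \<bar>e\<bar> \<le> 1 \<and> c v - c u = 3 * int p + e + k * (2 * (3 * int p)))" for u v
  have Rsym: "R u v" if "R v u" for u v
  proof -
    from that obtain e k where e: "\<bar>e\<bar> \<le> 1" "c u - c v = 3 * int p + e + k * (2 * (3 * int p))"
      unfolding R_def by blast
    then have "c v - c u = 3 * int p + (- e) + (- k - 1) * (2 * (3 * int p))" by (simp add: algebra_simps)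
    then show ?thesis using e(1) unfolding R_def by (metis abs_minus_cancel)
  qed

  \<comment> \<open>Edges are almost antipodal\<close>
  have main: "R u v" if uv: "(u, v) \<in> E" and le: "\<tau> u \<le> \<tau> v" for u v
  proof -
    have vu: "(v, u) \<in> E" using uv sym by (auto dest: symD)
    have u: "u \<in> Domain E" and v: "v \<in> Domain E" using uv vu by auto
    show ?thesis
    proof (cases "\<tau> u \<le> r")
      case True
      \<comment> \<open>The two colours seen from \<open>u\<close> are all that \<open>v\<close> can
        see one step later. So \<open>v\<close> is one step further from the same border, and
        \<open>c\<close> changes by a half turn and one unit.\<close>
      have sub: "A u (\<tau> u) \<subseteq> A v (Suc (\<tau> u))" by (rule step[OF uv True])
      have "card (A v (Suc (\<tau> u))) \<le> card (A u (\<tau> u))" using le2[OF v] \<tau>(1)[OF u] True by simp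
      then have eq: "A u (\<tau> u) = A v (Suc (\<tau> u))" using sub finA by (meson card_seteq)
      then have "\<tau> v \<le> Suc (\<tau> u)" using \<tau>(1)[OF u] \<tau>le by simp
      moreover have "\<tau> v \<noteq> \<tau> u"
      proof
        assume e: "\<tau> v = \<tau> u"
        have "card (A u (\<tau> u) \<union> A v (\<tau> u)) = 4"
          using card_Un_disjoint[OF finA finA disj[OF uv True]] \<tau>(1)[OF u] \<tau>(1)[OF v] e by simp
        moreover have "card (A u (\<tau> u) \<union> A v (\<tau> u)) \<le> card {..<3::nat}"
          using A3 by (intro card_mono) auto
        ultimately show False by simp
      qed
      ultimately have \<tau>v: "\<tau> v = Suc (\<tau> u)" using le by simp
      have "{..<3} - {z u} = {..<3} - {z v}" using eq z(2)[OF u] z(2)[OF v] \<tau>v by simp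
      then have "z v \<notin> {..<3} - {z u}" by simp
      then have zz: "z v = z u" using z(1)[OF v] by simp
      have ss: "s v = s u" if "\<tau> u \<noteq> 1"
      proof -
        have 2: "\<tau> u \<ge> 2" using that \<tau>pos[OF u] by simp
        have "A u (\<tau> u - 2) \<subseteq> A v (Suc (\<tau> u - 2))" using True by (intro step[OF uv]) simp
        moreover have "Suc (\<tau> u - 2) = \<tau> v - 2" using 2 \<tau>v by simp
        ultimately show ?thesis using s[OF u] s[OF v] by simp
      qed
      have "D (z v) (s v) * (int (\<tau> u) - 1) = D (z u) (s u) * (int (\<tau> u) - 1)"
        using ss zz by (cases "\<tau> u = 1") auto
      then have "c v - c u = 3 * int p + D (z v) (s v) + 0 * (2 * (3 * int p))"
        unfolding c_def \<tau>v zz by (simp add: algebra_simps)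
      moreover have "\<bar>D (z v) (s v)\<bar> \<le> 1" by (simp add: D_def)
      ultimately show ?thesis unfolding R_def by blast
    next
      case False
      then have t: "\<tau> u = Suc r" "\<tau> v = Suc r" using \<tau>(2)[OF u] \<tau>(2)[OF v] le by auto
      \<comment> \<open>Here both ends are as far from a border as possible: each sees only one
        colour at time \<open>r\<close>, namely its \<open>z\<close>.\<close>
      have Ar: "A w r = {z w}" if w: "w \<in> Domain E" "\<tau> w = Suc r" for w
      proof -
        have "{..<3} - N w r = {..<3} - {z w}" using z(2)[OF w(1)] w(2) by (simp add: A_def)
        then have "{..<3} - ({..<3} - N w r) = {..<3} - ({..<3} - {z w})" by simp
        then have "N w r = {z w}" using N3[of w r] z(1)[OF w(1)] by (simp add: double_diff)
        then show ?thesis by (simp add: A_def)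
      qed
      have zz: "z u \<noteq> z v" using disj[OF uv, of r] Ar[OF u t(1)] Ar[OF v t(2)] by auto
      have ss: "s u = z v" "s v = z u" if "r \<noteq> 0"
      proof -
        have m: "\<tau> u - 2 = r - 1" "\<tau> v - 2 = r - 1" "Suc (r - 1) = r" using t that by auto
        show "s u = z v" using step[OF uv, of "r - 1"] s[OF u] Ar[OF v t(2)] unfolding m by simp
        show "s v = z u" using step[OF vu, of "r - 1"] s[OF v] Ar[OF u t(1)] unfolding m by simp
      qed
      have D: "D (z u) (s u) * int r = D (z u) (z v) * int r"
        "D (z v) (s v) * int r = D (z v) (z u) * int r"
        using ss by (cases "r = 0"; simp)+
      have c: "c v - c u = 2 * int p * (int (z v) - int (z u)) + (D (z v) (z u) - D (z u) (z v)) * int r"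
        unfolding c_def t using D by (cases "r = 0") (auto simp: algebra_simps)
      \<comment> \<open>Since \<open>p = 2 * r + 1\<close>, the differences are
        \<open>2 * p + 2 * r = 3 * p - 1\<close> and \<open>4 * p - 2 * r = 3 * p + 1\<close>, up to
        sign and full turns.\<close>
      consider "z u = 0" "z v = 1" | "z u = 0" "z v = 2" | "z u = 1" "z v = 0"
        | "z u = 1" "z v = 2" | "z u = 2" "z v = 0" | "z u = 2" "z v = 1"
        using z(1)[OF u] z(1)[OF v] zz by linarith
      then show ?thesis
      proof cases
        case 1
        then show ?thesis unfolding R_def c by (intro exI[of _ "-1"] exI[of _ 0]) (simp add: D_def p)
      next
        case 2
        then show ?thesis unfolding R_def c by (intro exI[of _ "1"] exI[of _ 0]) (simp add: D_def p)
      next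
        case 3
        then show ?thesis unfolding R_def c by (intro exI[of _ "1"] exI[of _ "-1"]) (simp add: D_def p)
      next
        case 4
        then show ?thesis unfolding R_def c by (intro exI[of _ "-1"] exI[of _ 0]) (simp add: D_def p)
      next
        case 5
        then show ?thesis unfolding R_def c by (intro exI[of _ "-1"] exI[of _ "-1"]) (simp add: D_def p)
      next
        case 6
        then show ?thesis unfolding R_def c by (intro exI[of _ "1"] exI[of _ "-1"]) (simp add: D_def p)
      qed
    qed
  qed
  have "R u v" if "(u, v) \<in> E" for u v
  proof (cases "\<tau> u \<le> \<tau> v")
    case True
    then show ?thesis using main that by blast
  next
    case False
    moreover have "(v, u) \<in> E" using that sym by (auto dest: symD)
    ultimately show ?thesis using main[of v u] Rsym by simp
  qed
  then show ?thesis unfolding R_def antipodal_def by blast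
qed

text \<open>Both sides amount to a map of the subdivision to the circle of length
  \<open>6 * p\<close> with deviation 1. Walks of length \<open>q\<close> turn it into a map of
  \<open>G\<close> with deviation \<open>q\<close>, and walks of length \<open>p\<close> into a
  3-colouring. If \<open>q\<close> \<ge> \<open>3 * p\<close>, the permitted deviation reaches a
  half turn and constrains nothing.\<close>

lemma frac_power_3_colorable_iff:
  assumes G: "pair_graph G" and p: "odd p" and q: "odd q"
  shows "(\<exists>f. proper_coloring (frac_power G p q) 3 f) \<longleftrightarrow>
    q \<ge> 3 * p \<or> (\<exists>c. circ_coloring (parcs G) (6 * int p) (3 * int p - int q) c)"
proof
  interpret G: pair_graph G by fact
  have q0: "q \<ge> 1" and p0: "p > 0" using p q by (auto elim: oddE)
  interpret S: pair_graph "subdiv q G" by (rule pair_graph_subdiv[OF G q0])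
  let ?E = "parcs (subdiv q G)"
  have sym: "sym ?E" by (rule sym_parcs) unfold_locales
  have symG: "sym (parcs G)" by (rule sym_parcs[OF G])
  have arcs: "parcs (frac_power G p q) = ?E ^^ p \<inter> pverts (subdiv q G) \<times> UNIV"
    by (simp add: frac_power_def parcs_graph_power[OF S.pair_wf_digraph_axioms])
  have verts: "pverts (frac_power G p q) = pverts (subdiv q G)"
    by (simp add: frac_power_def graph_power_def)
  {
    assume "\<exists>f. proper_coloring (frac_power G p q) 3 f"
    then obtain f where f: "proper_coloring (frac_power G p q) 3 f" by blast
    obtain r where r: "p = 2 * r + 1" using p by (rule oddE)
    \<comment> \<open>Reduction mod 3 bounds the colours on the whole type, also outside the
      graph.\<close>
    have "f x mod 3 \<noteq> f y mod 3" if xy: "(x, y) \<in> ?E ^^ p" for x y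
    proof -
      have "(y, x) \<in> ?E ^^ p" using xy relpow_sym[OF sym] by (auto dest: symD)
      then have "\<exists>z. (x, z) \<in> ?E" "\<exists>z. (y, z) \<in> ?E"
        using xy relpow_Suc_D2[of _ _ "2 * r" ?E] unfolding r by force+
      then have v: "x \<in> pverts (subdiv q G)" "y \<in> pverts (subdiv q G)" using S.in_arcsD1 by auto
      then have "f x < 3" "f y < 3" using f verts by (auto simp: proper_coloring_def)
      moreover have "(x, y) \<in> parcs (frac_power G p q)" using xy v(1) arcs by simp
      then have "f x \<noteq> f y" using f by (auto simp: proper_coloring_def)
      ultimately show ?thesis by simp
    qed
    then obtain c where "antipodal ?E (3 * int p) 1 c"
      using three_coloring_odd_power_imp_antipodal[OF sym r, of "\<lambda>x. f x mod 3"] by auto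
    then have a: "antipodal (?E ^^ q) (3 * int p) (int q) c" using antipodal_relpow[OF _ q] by fastforce
    have "antipodal (parcs G) (3 * int p) (int q) (\<lambda>v. c (Inl v))"
      unfolding antipodal_def
    proof safe
      fix u v assume "(u, v) \<in> parcs G"
      from subdiv_edge_relpow[OF this q0] a
      show "\<exists>e z. \<bar>e\<bar> \<le> int q \<and> c (Inl v) - c (Inl u) = 3 * int p + e + z * (2 * (3 * int p))"
        unfolding antipodal_def by blast
    qed
    then have "circ_coloring (parcs G) (6 * int p) (3 * int p - int q) (\<lambda>v. c (Inl v))" if "\<not> q \<ge> 3 * p"
      using antipodal_iff_circ_coloring[OF symG, of "int q" "3 * int p"] that by simp
    then show "q \<ge> 3 * p \<or> (\<exists>c. circ_coloring (parcs G) (6 * int p) (3 * int p - int q) c)" by blast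
  }
  {
    assume R: "q \<ge> 3 * p \<or> (\<exists>c. circ_coloring (parcs G) (6 * int p) (3 * int p - int q) c)"
    have "\<exists>g. antipodal ?E (3 * int p) 1 g"
    proof (cases "q \<ge> 3 * p")
      case True
      obtain o' :: "'a \<Rightarrow> nat" where o': "inj_on o' (pverts G)"
        using finite_imp_inj_to_nat_seg[OF G.pair_finite_verts] by blast
      have ne: "o' u \<noteq> o' v" if "(u, v) \<in> parcs G" for u v
        using that o' G.in_arcsD1 G.in_arcsD2 G.no_loops' by (metis inj_onD)
      \<comment> \<open>For the constant map 0 every edge has deviation of a half turn; the
        numbering of the vertices chooses its sign antisymmetrically.\<close>
      define e where "e u v = (if o' u < o' v then 3 * int p else - (3 * int p))" for u v
      show ?thesis
      proof (rule antipodal_subdiv[OF G q, of e "\<lambda>_. 0"], intro conjI)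
        fix u v assume "(u, v) \<in> parcs G"
        then show "e v u = - e u v" using ne[of u v] by (auto simp: e_def)
        show "\<bar>e u v\<bar> \<le> int q" using True by (simp add: e_def)
        show "\<exists>z. 0 - 0 = 3 * int p + e u v + z * (2 * (3 * int p))"
          by (cases "o' u < o' v") (auto simp: e_def intro: exI[of _ "-1"] exI[of _ 0])
      qed
    next
      case False
      then obtain c where c: "circ_coloring (parcs G) (6 * int p) (3 * int p - int q) c" using R by blast
      define e where "e u v = (c v - c u) mod (6 * int p) - 3 * int p" for u v
      show ?thesis
      proof (rule antipodal_subdiv[OF G q, of e c], intro conjI)
        fix u v assume uv: "(u, v) \<in> parcs G"
        have vu: "(v, u) \<in> parcs G" using uv symG by (auto dest: symD)
        have m: "3 * int p - int q \<le> (c v - c u) mod (6 * int p)"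
          "3 * int p - int q \<le> (c u - c v) mod (6 * int p)"
          using c uv vu by (auto simp: circ_coloring_def)
        \<comment> \<open>The residues of a difference and of its negative are positive by
          \<open>m\<close>, hence add up to \<open>6 * p\<close>.\<close>
        show s: "e v u = - e u v"
          using zmod_zminus1_eq_if[of "c v - c u" "6 * int p"] m False by (auto simp: e_def split: if_splits)
        show "\<bar>e u v\<bar> \<le> int q" using m s unfolding e_def by linarith
        have "c v - c u = 3 * int p + e u v + (c v - c u) div (6 * int p) * (2 * (3 * int p))"
          using div_mult_mod_eq[of "c v - c u" "6 * int p"] by (simp add: e_def)
        then show "\<exists>z. c v - c u = 3 * int p + e u v + z * (2 * (3 * int p))" by blast
      qed
    qed
    then obtain g where "antipodal ?E (3 * int p) 1 g" by blast
    then have a: "antipodal (?E ^^ p) (3 * int p) (int p) g" using antipodal_relpow[OF _ p] by fastforce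
    let ?f = "\<lambda>x. (g x mod (6 * int p)) div (2 * int p)"
    have f0: "?f x \<ge> 0" for x using p0 by (simp add: pos_imp_zdiv_nonneg_iff)
    have f3: "?f x < 3" for x
    proof -
      have "g x mod (6 * int p) < 3 * (2 * int p)" using p0 by simp
      then have "g x mod (6 * int p) div (2 * int p) \<le> (2 * int p - 1 + 2 * (2 * int p)) div (2 * int p)"
        using p0 by (intro zdiv_mono1) auto
      also have "\<dots> = (2 * int p - 1) div (2 * int p) + 2" using p0 by (subst div_mult_self1) auto
      also have "(2 * int p - 1) div (2 * int p) = 0" using p0 by (intro div_pos_pos_trivial) auto
      finally show ?thesis by simp
    qed
    have "proper_coloring (frac_power G p q) 3 (\<lambda>x. nat (?f x))"
      unfolding proper_coloring_def
    proof safe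
      fix x show "nat (?f x) < 3" using f3[of x] f0[of x] by linarith
    next
      fix x y assume xy: "(x, y) \<in> parcs (frac_power G p q)" "nat (?f x) = nat (?f y)"
      then have "(x, y) \<in> ?E ^^ p" using arcs by simp
      then have "?f x \<noteq> ?f y" using antipodal_imp_3_coloring[OF a] p0 by simp
      then show False using xy(2) f0[of x] f0[of y] by (simp add: eq_nat_nat_iff)
    qed
    then show "\<exists>f. proper_coloring (frac_power G p q) 3 f" by blast
  }
qed

subsection \<open>The circular chromatic number\<close>

lemma proper_coloring_imp_circ_coloring:
  assumes "pair_wf_digraph G" "proper_coloring G k c" "k > 0"
  shows "circ_coloring (parcs G) (int k) 1 (\<lambda>v. int (c v))"
  unfolding circ_coloring_def
proof safe
  interpret pair_wf_digraph G by fact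
  fix u v assume uv: "(u, v) \<in> parcs G"
  then have V: "u \<in> pverts G" "v \<in> pverts G" using in_arcsD1 in_arcsD2 by auto
  then have c: "c u \<noteq> c v" "c u < k" "c v < k" using assms(2) uv by (auto simp: proper_coloring_def)
  have "\<not> int k dvd int (c v) - int (c u)"
  proof
    assume "int k dvd int (c v) - int (c u)"
    then have "\<bar>int k\<bar> \<le> \<bar>int (c v) - int (c u)\<bar>" using c(1) by (intro dvd_imp_le_int) auto
    then show False using c by linarith
  qed
  then have "(int (c v) - int (c u)) mod int k \<noteq> 0" by (simp add: dvd_eq_mod_eq_0)
  moreover have "(int (c v) - int (c u)) mod int k \<ge> 0" using assms(3) by simp
  ultimately show "1 \<le> (int (c v) - int (c u)) mod int k" by linarith
qed

text \<open>By the reduction, the minimum over the finite set \<open>S\<close> is a minimum over all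
  fractions; this gives the \<open>LEAST\<close> over the reals its intended value.\<close>

lemma circular_chromatic_number_attained:
  assumes "pair_graph G"
  shows "\<exists>n d. circular_chromatic_number G = real n / real d \<and> n \<ge> 2 * d \<and> d \<ge> 1 \<and>
      (\<exists>c. circ_coloring (parcs G) (int n) (int d) c)"
    and "circ_coloring (parcs G) (int n) (int d) c \<Longrightarrow> n \<ge> 2 * d \<Longrightarrow> d \<ge> 1 \<Longrightarrow>
      circular_chromatic_number G \<le> real n / real d"
proof -
  interpret pair_graph G by fact
  define P where "P n d \<longleftrightarrow> n \<ge> 2 * d \<and> d \<ge> 1 \<and> (\<exists>c. circ_coloring (parcs G) (int n) (int d) c)" for n d
  define S where "S = {(n, d). n \<le> max 2 (card (pverts G)) \<and> P n d}"
  let ?v = "\<lambda>(n, d). real n / real d"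
  have "S \<subseteq> {..max 2 (card (pverts G))} \<times> {..max 2 (card (pverts G))}" by (auto simp: S_def P_def)
  then have fin: "finite S" by (rule finite_subset) simp
  have red: "\<exists>nd\<in>S. ?v nd \<le> real n / real d" if nd: "P n d" for n d
  proof -
    have "parcs G \<subseteq> pverts G \<times> pverts G" using in_arcsD1 in_arcsD2 by auto
    moreover obtain c where "circ_coloring (parcs G) (int n) (int d) c" using nd by (auto simp: P_def)
    ultimately obtain n' d' c' where r: "circ_coloring (parcs G) (int n') (int d') c'"
      "n' \<le> max 2 (card (pverts G))" "n' \<ge> 2 * d'" "d' \<ge> 1" "n' * d \<le> n * d'"
      using circ_coloring_reduce[OF sym_parcs[OF assms] _ pair_finite_verts] nd P_def by blast
    have "real n' * real d \<le> real n * real d'" using r(5) by (metis of_nat_mono of_nat_mult)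
    then have "real n' / real d' \<le> real n / real d"
      using r(4) nd by (simp add: P_def field_simps)
    moreover have "(n', d') \<in> S" using r by (auto simp: S_def P_def)
    ultimately show ?thesis by (intro bexI[of _ "(n', d')"]) auto
  qed
  have "\<exists>n d. P n d"
  proof -
    obtain c :: "'a \<Rightarrow> nat" and k where c: "c ` pverts G = {i. i < k}" "inj_on c (pverts G)"
      using finite_imp_inj_to_nat_seg[OF pair_finite_verts] by blast
    \<comment> \<open>The two extra colours secure \<open>n\<close> \<ge> \<open>2 * d\<close> even
      for graphs with fewer than two vertices.\<close>
    have "proper_coloring G (k + 2) c"
      unfolding proper_coloring_def
    proof safe
      fix v assume "v \<in> pverts G"
      then have "c v \<in> {i. i < k}" using c(1) by blast
      then show "c v < k + 2" by simp
    next
      fix u v assume "(u, v) \<in> parcs G" "c u = c v"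
      then show False using in_arcsD1 in_arcsD2 no_loops' c(2) by (metis inj_onD)
    qed
    then have "P (k + 2) 1"
      using proper_coloring_imp_circ_coloring[OF pair_wf_digraph_axioms, of "k + 2" c]
      unfolding P_def by auto
    then show ?thesis by blast
  qed
  then have ne: "S \<noteq> {}" using red by blast
  obtain n0 d0 where m: "(n0, d0) \<in> S" "\<And>nd. nd \<in> S \<Longrightarrow> ?v (n0, d0) \<le> ?v nd"
    using arg_min_if_finite[OF fin ne, of ?v] by (metis not_le surj_pair)
  have low: "real n0 / real d0 \<le> real n / real d" if "P n d" for n d
    using red[OF that] m(2) by fastforce
  have P0: "P n0 d0" using m(1) by (simp add: S_def)
  have eq: "circular_chromatic_number G = real n0 / real d0"
    unfolding circular_chromatic_number_def
  proof (rule Least_equality)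
    show "\<exists>n d. real n0 / real d0 = real n / real d \<and> n \<ge> 2 * d \<and> 2 * d \<ge> 2 \<and>
       (\<exists>f. graph_hom G (circular_complete n d) f)"
      using P0 graph_hom_circular_complete_iff[OF assms, of d0 n0]
      by (intro exI[of _ n0] exI[of _ d0]) (auto simp: P_def)
  next
    fix y assume "\<exists>n d. y = real n / real d \<and> n \<ge> 2 * d \<and> 2 * d \<ge> 2 \<and>
       (\<exists>f. graph_hom G (circular_complete n d) f)"
    then obtain n d where y: "y = real n / real d" "n \<ge> 2 * d" "d \<ge> 1"
      "\<exists>f. graph_hom G (circular_complete n d) f" by auto
    then have "P n d" using graph_hom_circular_complete_iff[OF assms y(2,3)] by (auto simp: P_def)
    then show "real n0 / real d0 \<le> y" using low y(1) by simp
  qed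
  show "\<exists>n d. circular_chromatic_number G = real n / real d \<and> n \<ge> 2 * d \<and> d \<ge> 1 \<and>
      (\<exists>c. circ_coloring (parcs G) (int n) (int d) c)"
    using eq P0 unfolding P_def by blast
  show "circ_coloring (parcs G) (int n) (int d) c \<Longrightarrow> n \<ge> 2 * d \<Longrightarrow> d \<ge> 1 \<Longrightarrow>
      circular_chromatic_number G \<le> real n / real d"
    unfolding eq by (rule low) (auto simp: P_def)
qed

text \<open>A colouring attaining the minimum is rescaled to any larger fraction.\<close>

lemma circ_colorable_iff_circular_chromatic_number_le:
  assumes "pair_graph G" "n \<ge> 2 * d" "d \<ge> 1"
  shows "(\<exists>c. circ_coloring (parcs G) (int n) (int d) c) \<longleftrightarrow>
    circular_chromatic_number G \<le> real n / real d"
proof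
  assume "\<exists>c. circ_coloring (parcs G) (int n) (int d) c"
  then show "circular_chromatic_number G \<le> real n / real d"
    using circular_chromatic_number_attained(2)[OF assms(1)] assms(2,3) by blast
next
  assume le: "circular_chromatic_number G \<le> real n / real d"
  obtain n0 d0 c where m: "circular_chromatic_number G = real n0 / real d0" "n0 \<ge> 2 * d0" "d0 \<ge> 1"
    "circ_coloring (parcs G) (int n0) (int d0) c"
    using circular_chromatic_number_attained(1)[OF assms(1)] by blast
  have "real n0 * real d \<le> real n * real d0" using le m(1,3) assms(3) by (simp add: field_simps)
  then have "n0 * d \<le> n * d0" by (metis of_nat_le_iff of_nat_mult)
  then have "int n0 * int d \<le> int n * int d0" by (metis of_nat_le_iff of_nat_mult)
  then have "circ_coloring (parcs G) (int n) (int d) (\<lambda>v. (c v * int n) div int n0)"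
    using m(2,3) assms(3) by (intro circ_coloring_mono[OF m(4) sym_parcs[OF assms(1)]]) auto
  then show "\<exists>c. circ_coloring (parcs G) (int n) (int d) c" by blast
qed

section \<open>Numerical criteria for chromatic number 3\<close>

lemma circular_chromatic_number_ge_2:
  assumes "pair_graph G"
  shows "circular_chromatic_number G \<ge> 2"
proof -
  obtain n d where nd: "circular_chromatic_number G = real n / real d" "n \<ge> 2 * d" "d \<ge> 1"
    using circular_chromatic_number_attained(1)[OF assms] by blast
  then have "real n \<ge> 2 * real d" by linarith
  then show ?thesis unfolding nd(1) using nd(3) by (simp add: le_divide_eq)
qed

lemma circular_chromatic_number_le:
  assumes "pair_graph G" "proper_coloring G k c" "k \<ge> 2"
  shows "circular_chromatic_number G \<le> real k"
proof -
  interpret pair_graph G by fact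
  have "circ_coloring (parcs G) (int k) (int 1) (\<lambda>v. int (c v))"
    using proper_coloring_imp_circ_coloring[OF pair_wf_digraph_axioms assms(2)] assms(3) by simp
  then show ?thesis using circular_chromatic_number_attained(2)[OF assms(1), of k 1] assms(3) by simp
qed

text \<open>Non-bipartiteness excludes fewer than three colours. The product form also covers
  \<open>q\<close> \<ge> \<open>3 * p\<close>, where the left factor product is at most 0 and a
  3-colouring always exists.\<close>

lemma frac_power_3_chromatic_iff:
  assumes G: "pair_graph G" "\<not> bipartite G" and p: "odd p" and q: "odd q"
  shows "chromatic_number (frac_power G p q) = 3 \<longleftrightarrow>
    circular_chromatic_number G * (3 * real p - real q) \<le> 6 * real p"
proof -
  have "\<nexists>c. proper_coloring (frac_power G p q) j c" if "j < 3" for j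
    using frac_power_not_2_colorable[OF G p q] proper_coloring_mono[of _ j _ 2] that by fastforce
  then have "chromatic_number (frac_power G p q) = 3 \<longleftrightarrow>
      (\<exists>f. proper_coloring (frac_power G p q) 3 f)"
    using chromatic_number_eq_iff[of "frac_power G p q" 3] by (auto simp: numeral_eq_enat)
  also have "\<dots> \<longleftrightarrow> circular_chromatic_number G * (3 * real p - real q) \<le> 6 * real p"
  proof (cases "q \<ge> 3 * p")
    case True
    then have "3 * real p - real q \<le> 0" by linarith
    then have "circular_chromatic_number G * (3 * real p - real q) \<le> 0"
      using circular_chromatic_number_ge_2[OF G(1)] by (intro mult_nonneg_nonpos) auto
    also have "\<dots> \<le> 6 * real p" by simp
    finally show ?thesis using True frac_power_3_colorable_iff[OF G(1) p q] by simp
  next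
    case False
    then have d: "int (3 * p - q) = 3 * int p - int q" "real (3 * p - q) = 3 * real p - real q"
      "3 * real p - real q > 0" by linarith+
    have "(\<exists>f. proper_coloring (frac_power G p q) 3 f) \<longleftrightarrow>
        (\<exists>c. circ_coloring (parcs G) (int (6 * p)) (int (3 * p - q)) c)"
      using False frac_power_3_colorable_iff[OF G(1) p q] unfolding d by simp
    also have "\<dots> \<longleftrightarrow> circular_chromatic_number G \<le> real (6 * p) / real (3 * p - q)"
      using False by (intro circ_colorable_iff_circular_chromatic_number_le[OF G(1)]) auto
    also have "\<dots> \<longleftrightarrow> circular_chromatic_number G * (3 * real p - real q) \<le> 6 * real p"
      unfolding d(2) using d(3) by (simp add: le_divide_eq)
    finally show ?thesis .
  qed
  finally show ?thesis .
qed

text \<open>With \<open>m = n - t\<close> the fraction is 2 + (2t + 1)/m; for fixed \<open>m\<close>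
  such values are spaced 2/m apart.\<close>

lemma ex_odd_fraction_between:
  fixes a b :: real
  assumes "2 \<le> a" "a < b"
  shows "\<exists>n t :: nat. n > t \<and> t > 0 \<and> a \<le> real (2 * n + 1) / (real n - real t) \<and>
    real (2 * n + 1) / (real n - real t) < b"
proof -
  \<comment> \<open>Rounding \<open>t\<close> up and adding 1 for positivity gives
    \<open>2 * t + 1\<close> \<le> \<open>m * (a - 2) + 5\<close>, hence the constant 5.\<close>
  obtain m :: nat where m: "real m > 5 / (b - a)" using reals_Archimedean2 by blast
  then have mb: "real m * (b - a) > 5" using assms by (simp add: field_simps)
  have m0: "real m > 0" using m assms by (smt (verit) divide_pos_pos)
  define t where "t = nat \<lceil>real m * (a - 2) / 2\<rceil> + 1"
  have nn: "real m * (a - 2) / 2 \<ge> 0" using assms m0 by simp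
  have t: "real t \<ge> real m * (a - 2) / 2 + 1" "real t \<le> real m * (a - 2) / 2 + 2"
    using nn unfolding t_def by linarith+
  have eq: "real (2 * (m + t) + 1) / (real (m + t) - real t) = 2 + (2 * real t + 1) / real m"
    using m0 by (simp add: field_simps)
  have "(a - 2) * real m \<le> 2 * real t + 1" using t(1) by (simp add: field_simps)
  then have 1: "a - 2 \<le> (2 * real t + 1) / real m" using m0 by (simp add: le_divide_eq)
  have "2 * real t + 1 < (b - 2) * real m" using t(2) mb by (simp add: field_simps)
  then have 2: "(2 * real t + 1) / real m < b - 2" using m0 by (simp add: divide_less_eq)
  show ?thesis
    using eq 1 2 m0 by (intro exI[of _ "m + t"] exI[of _ t]) (auto simp: t_def)
qed

theorem theorem4p1:
  fixes G :: "'a pair_pre_digraph" and k :: nat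
  assumes "pair_graph G"
    and "\<not> bipartite G"
    and "chromatic_number G = enat k"
  shows "(real k \<noteq> circular_chromatic_number G \<longleftrightarrow>
           (\<exists>r s :: nat. real (2 * r + 1) / real (2 * s + 1) > real k / (3 * (real k - 2)) \<and>
              chromatic_number (frac_power G (2 * r + 1) (2 * s + 1)) = 3))
       \<and> circular_chromatic_number G =
           Inf {real (2 * n + 1) / (real n - real t) |n t :: nat.
              chromatic_number (frac_power G (2 * n + 1) (3 * (2 * t + 1))) = 3 \<and> n > t \<and> t > 0}
       \<and> (\<forall>r s :: nat. real (2 * r + 1) / real (2 * s + 1) \<le> real k / (3 * (real k - 2)) \<longrightarrow>
              chromatic_number (frac_power G (2 * r + 1) (2 * s + 1)) = 3)"
proof -
  interpret pair_graph G by fact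
  let ?x = "circular_chromatic_number G"
  obtain c where c: "proper_coloring G k c" using assms(3) chromatic_number_eq_iff by blast
  have k: "k \<ge> 3"
  proof (rule ccontr)
    assume "\<not> k \<ge> 3"
    then have "proper_coloring G 2 c" by (intro proper_coloring_mono[OF c]) simp
    then show False using bipartite_if_2_colorable[OF pair_wf_digraph_axioms] assms(2) by blast
  qed
  have xk: "?x \<le> real k" using circular_chromatic_number_le[OF assms(1) c] k by simp
  have x2: "?x \<ge> 2" by (rule circular_chromatic_number_ge_2[OF assms(1)])
  have chi3: "chromatic_number (frac_power G (2 * r + 1) (2 * s + 1)) = 3 \<longleftrightarrow>
      ?x * (3 * real (2 * r + 1) - real (2 * s + 1)) \<le> 6 * real (2 * r + 1)" for r s
    by (rule frac_power_3_chromatic_iff[OF assms(1,2)]) auto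
  have chi3': "chromatic_number (frac_power G (2 * n + 1) (3 * (2 * t + 1))) = 3 \<longleftrightarrow>
      ?x \<le> real (2 * n + 1) / (real n - real t)" if "n > t" for n t
  proof -
    have q: "2 * (3 * t + 1) + 1 = 3 * (2 * t + 1)" by simp
    \<comment> \<open>The factor 3 in the denominator turns \<open>3 * p - q\<close> into
      \<open>6 * (n - t)\<close>, and the 6 cancels.\<close>
    have d: "3 * real (2 * n + 1) - real (3 * (2 * t + 1)) = 6 * (real n - real t)" by simp
    have "chromatic_number (frac_power G (2 * n + 1) (3 * (2 * t + 1))) = 3 \<longleftrightarrow>
        6 * (?x * (real n - real t)) \<le> 6 * real (2 * n + 1)"
      using chi3[of n "3 * t + 1"] unfolding q d by (simp only: mult.left_commute[of ?x])
    also have "\<dots> \<longleftrightarrow> ?x * (real n - real t) \<le> real (2 * n + 1)" by (rule mult_le_cancel_left_pos) simp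
    also have "\<dots> \<longleftrightarrow> ?x \<le> real (2 * n + 1) / (real n - real t)"
      using that by (simp only: pos_le_divide_eq diff_gt_0_iff_gt of_nat_less_iff)
    finally show ?thesis .
  qed
  \<comment> \<open>The threshold is the criterion \<open>chi3\<close> with \<open>k\<close> in
    place of the circular chromatic number. If the two numbers agree, no exponent beyond the
    threshold gives chromatic number 3.\<close>
  have thr: "real (2 * r + 1) / real (2 * s + 1) \<le> real k / (3 * (real k - 2)) \<longleftrightarrow>
      real k * (3 * real (2 * r + 1) - real (2 * s + 1)) \<le> 6 * real (2 * r + 1)" for r s :: nat
  proof -
    have pos: "real (2 * s + 1) > 0" "3 * (real k - 2) > 0" using k by auto
    have "real (2 * r + 1) / real (2 * s + 1) \<le> real k / (3 * (real k - 2)) \<longleftrightarrow>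
        real (2 * r + 1) * (3 * (real k - 2)) \<le> real k * real (2 * s + 1)"
      using pos by (simp only: pos_divide_le_eq pos_le_divide_eq times_divide_eq_left)
    then show ?thesis by (simp add: algebra_simps)
  qed
  have "real k \<noteq> ?x \<longleftrightarrow>
           (\<exists>r s :: nat. real (2 * r + 1) / real (2 * s + 1) > real k / (3 * (real k - 2)) \<and>
              chromatic_number (frac_power G (2 * r + 1) (2 * s + 1)) = 3)" (is "?L \<longleftrightarrow> ?R")
  proof
    assume ?L
    then have "?x < real k" using xk by simp
    then obtain n t :: nat where nt: "n > t" "?x \<le> real (2 * n + 1) / (real n - real t)"
      "real (2 * n + 1) / (real n - real t) < real k" using ex_odd_fraction_between[OF x2] by blast
    have q: "3 * (2 * t + 1) = 2 * (3 * t + 1) + 1" by simp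
    have "chromatic_number (frac_power G (2 * n + 1) (2 * (3 * t + 1) + 1)) = 3"
      using chi3'[OF nt(1)] nt(2) unfolding q by blast
    moreover have "\<not> real (2 * n + 1) / real (2 * (3 * t + 1) + 1) \<le> real k / (3 * (real k - 2))"
    proof -
      have "real (2 * n + 1) < real k * (real n - real t)"
        using nt(1,3) by (simp only: pos_divide_less_eq diff_gt_0_iff_gt of_nat_less_iff)
      then have "6 * real (2 * n + 1) < 6 * (real k * (real n - real t))" 
        by (rule mult_strict_left_mono) simp
      also have "\<dots> = real k * (6 * (real n - real t))" by (rule mult.left_commute)
      also have "6 * (real n - real t) = 3 * real (2 * n + 1) - real (2 * (3 * t + 1) + 1)" by simp
      finally show ?thesis unfolding thr not_le .
    qed
    ultimately show ?R by (meson not_le)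
  next
    assume ?R
    then obtain r s :: nat where rs: "\<not> real (2 * r + 1) / real (2 * s + 1) \<le> real k / (3 * (real k - 2))"
      "chromatic_number (frac_power G (2 * r + 1) (2 * s + 1)) = 3" by (meson not_le)
    then show ?L unfolding thr chi3 by auto
  qed
  moreover have "?x = Inf {real (2 * n + 1) / (real n - real t) |n t :: nat.
              chromatic_number (frac_power G (2 * n + 1) (3 * (2 * t + 1))) = 3 \<and> n > t \<and> t > 0}"
    (is "_ = Inf ?S")
  proof (rule cInf_eq_non_empty[symmetric])
    have ex: "\<exists>y\<in>?S. y < b" if b: "?x < b" for b
    proof -
      obtain n t :: nat where nt: "n > t" "t > 0" "?x \<le> real (2 * n + 1) / (real n - real t)"
        "real (2 * n + 1) / (real n - real t) < b" using ex_odd_fraction_between[OF x2 b] by blast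
      then have "real (2 * n + 1) / (real n - real t) \<in> ?S" using chi3'[OF nt(1)] by blast
      then show ?thesis using nt(4) by blast
    qed
    show "?S \<noteq> {}" using ex[of "?x + 1"] by auto
    show "?x \<le> y" if "y \<in> ?S" for y using that chi3' by auto
    show "y \<le> ?x" if "\<And>z. z \<in> ?S \<Longrightarrow> y \<le> z" for y using ex[of y] that by (meson not_le)
  qed
  moreover have "chromatic_number (frac_power G (2 * r + 1) (2 * s + 1)) = 3"
    if le: "real (2 * r + 1) / real (2 * s + 1) \<le> real k / (3 * (real k - 2))" for r s :: nat
    unfolding chi3
  \<comment> \<open>Replacing the circular chromatic number by the larger \<open>k\<close> preserves
    the inequality only for a nonnegative factor; for a negative one the left side is at most
    0.\<close>
  proof (cases "3 * real (2 * r + 1) - real (2 * s + 1) \<ge> 0")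
    case True
    then have "?x * (3 * real (2 * r + 1) - real (2 * s + 1)) \<le> real k * (3 * real (2 * r + 1) - real (2 * s + 1))"
      using xk by (intro mult_right_mono) auto
    also have "\<dots> \<le> 6 * real (2 * r + 1)" using le unfolding thr .
    finally show "?x * (3 * real (2 * r + 1) - real (2 * s + 1)) \<le> 6 * real (2 * r + 1)" .
  next
    case False
    then have "?x * (3 * real (2 * r + 1) - real (2 * s + 1)) \<le> 0"
      using x2 by (intro mult_nonneg_nonpos) auto
    also have "\<dots> \<le> 6 * real (2 * r + 1)" by simp
    finally show "?x * (3 * real (2 * r + 1) - real (2 * s + 1)) \<le> 6 * real (2 * r + 1)" .
  qed
  ultimately show ?thesis by blast
qed

end
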